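(* Let $\mathcal{H}$ be a separable complex Hilbert space and let $P\in\mathcal{B}(\mathcal{H})$ be a bounded idempotent ($P^2=P$, not necessarily self-adjoint). Then: (i) The set $\{J\in\mathcal{B}(\mathcal{H}): JP\geqslant 0,\ J=J^{\ast}=J^{-1}\}$ has a maximum in the Loewner partial order, and $$\max\{J: JP\geqslant0,\ J=J^{\ast}=J^{-1}\}=2P_{(P+P^{\ast})^{+}}-I+2P_{N(P+P^{\ast})}.$$ (ii) The following statements are equivalent: (a) $\max\{J: JPJ=P^{*},\ J=J^{\ast}=J^{-1}\}$ exists; (b) $P$ is an orthogonal projection; (c) $\max\{J: JPJ=P^{*},\ J=J^{\ast}=J^{-1}\}=I$; (d) $\min\{J: JPJ=P^{*},\ J=J^{\ast}=J^{-1}\}$ exists; (e) $\min\{J: JPJ=P^{*},\ J=J^{\ast}=J^{-1}\}=-I$.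
   Context: $A\geqslant 0$ means $\langle Ax,x\rangle\geqslant 0$ for all $x$; for self-adjoint operators $A\geqslant B$ (Loewner order) means $A-B\geqslant 0$. The min (max) of a set of self-adjoint operators is an element of the set that is $\leqslant$ (respectively $\geqslant$) every element of the set in the Loewner order. In all the sets above $J$ ranges over $\mathcal{B}(\mathcal{H})$. For self-adjoint $A$, $A^{+}=\frac{|A|+A}{2}$ and $A^{-}=\frac{|A|-A}{2}$. $N(T)$ and $R(T)$ denote the null space and range of $T$. For a closed subspace $\mathcal{M}$, $P_{\mathcal{M}}$ is the orthogonal projection onto $\mathcal{M}$; for an operator $A$, $P_A$ is the orthogonal projection onto $\overline{R(A)}$. *)

theory Defs
  imports "HOL-Analysis.Analysis"
begin

text \<open>
  The distribution has real inner product spaces only. The inner product is linear in its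
  first argument; \<open>scaleC_scaleR\<close> says that the underlying real Banach space is the
  restriction of scalars.
\<close>

class complex_hilbert_space = banach +
  fixes scaleC :: "complex \<Rightarrow> 'a \<Rightarrow> 'a"  (infixr \<open>*\<^sub>C\<close> 75)
    and cinner :: "'a \<Rightarrow> 'a \<Rightarrow> complex"
  assumes scaleC_add_right: "c *\<^sub>C (x + y) = c *\<^sub>C x + c *\<^sub>C y"
    and scaleC_add_left: "(c + d) *\<^sub>C x = c *\<^sub>C x + d *\<^sub>C x"
    and scaleC_scaleC: "c *\<^sub>C (d *\<^sub>C x) = (c * d) *\<^sub>C x"
    and scaleC_scaleR: "complex_of_real r *\<^sub>C x = r *\<^sub>R x"
    and cinner_commute: "cinner x y = cnj (cinner y x)"
    and cinner_add_left: "cinner (x + y) z = cinner x z + cinner y z"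
    and cinner_scaleC_left: "cinner (c *\<^sub>C x) y = c * cinner x y"
    and cinner_norm: "cinner x x = complex_of_real ((norm x)\<^sup>2)"

instantiation complex :: complex_hilbert_space
begin

definition scaleC_complex :: "complex \<Rightarrow> complex \<Rightarrow> complex" where
  "scaleC_complex c x = c * x"

definition cinner_complex :: "complex \<Rightarrow> complex \<Rightarrow> complex" where
  "cinner_complex x y = x * cnj y"

instance
  by standard
    (simp_all add: scaleC_complex_def cinner_complex_def algebra_simps scaleR_conv_of_real
      complex_norm_square del: of_real_power)

end

text \<open>
  \<open>'a \<Rightarrow>\<^sub>L 'a\<close> consists of the real-linear bounded maps, so \<open>\<B>(\<H>)\<close> is the set of those
  that are complex-linear.
\<close>

definition bounded_ops :: "('a::complex_hilbert_space \<Rightarrow>\<^sub>L 'a) set" where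
  "bounded_ops = {A :: 'a \<Rightarrow>\<^sub>L 'a. \<forall>c x. A (c *\<^sub>C x) = c *\<^sub>C A x}"

text \<open>
  The descriptions below determine a unique operator: \<open>adj A\<close> and \<open>op_abs A\<close> for
  \<open>A \<in> bounded_ops\<close>, and \<open>orth_proj M\<close> for a closed complex-linear subspace \<open>M\<close>.
\<close>

definition adj :: "('a::complex_hilbert_space \<Rightarrow>\<^sub>L 'a) \<Rightarrow> ('a \<Rightarrow>\<^sub>L 'a)" where
  "adj A = (THE B. B \<in> bounded_ops \<and> (\<forall>x y. cinner (A x) y = cinner x (B y)))"

definition op_nonneg :: "('a::complex_hilbert_space \<Rightarrow>\<^sub>L 'a) \<Rightarrow> bool" where
  "op_nonneg A \<longleftrightarrow> (\<forall>x. cinner (A x) x \<in> \<real>\<^sub>\<ge>\<^sub>0)"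

definition loewner_le :: "('a::complex_hilbert_space \<Rightarrow>\<^sub>L 'a) \<Rightarrow> ('a \<Rightarrow>\<^sub>L 'a) \<Rightarrow> bool" where
  "loewner_le A B \<longleftrightarrow> op_nonneg (B - A)"

definition is_loewner_max ::
    "('a::complex_hilbert_space \<Rightarrow>\<^sub>L 'a) set \<Rightarrow> ('a \<Rightarrow>\<^sub>L 'a) \<Rightarrow> bool" where
  "is_loewner_max S M \<longleftrightarrow> M \<in> S \<and> (\<forall>J\<in>S. loewner_le J M)"

definition is_loewner_min ::
    "('a::complex_hilbert_space \<Rightarrow>\<^sub>L 'a) set \<Rightarrow> ('a \<Rightarrow>\<^sub>L 'a) \<Rightarrow> bool" where
  "is_loewner_min S M \<longleftrightarrow> M \<in> S \<and> (\<forall>J\<in>S. loewner_le M J)"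

definition op_abs :: "('a::complex_hilbert_space \<Rightarrow>\<^sub>L 'a) \<Rightarrow> ('a \<Rightarrow>\<^sub>L 'a)" where
  "op_abs A = (THE B. B \<in> bounded_ops \<and> op_nonneg B \<and> B o\<^sub>L B = adj A o\<^sub>L A)"

definition pos_part :: "('a::complex_hilbert_space \<Rightarrow>\<^sub>L 'a) \<Rightarrow> ('a \<Rightarrow>\<^sub>L 'a)" where
  "pos_part A = (1 / 2) *\<^sub>R (op_abs A + A)"

definition null_space :: "('a::complex_hilbert_space \<Rightarrow>\<^sub>L 'a) \<Rightarrow> 'a set" where
  "null_space A = {x. A x = 0}"

definition orth_proj :: "'a::complex_hilbert_space set \<Rightarrow> ('a \<Rightarrow>\<^sub>L 'a)" where
  "orth_proj M = (THE Q. Q \<in> bounded_ops \<and>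
     (\<forall>x. Q x \<in> M \<and> (\<forall>y\<in>M. cinner (x - Q x) y = 0)))"

definition range_proj :: "('a::complex_hilbert_space \<Rightarrow>\<^sub>L 'a) \<Rightarrow> ('a \<Rightarrow>\<^sub>L 'a)" where
  "range_proj A = orth_proj (closure (range A))"

definition is_orth_proj :: "('a::complex_hilbert_space \<Rightarrow>\<^sub>L 'a) \<Rightarrow> bool" where
  "is_orth_proj P \<longleftrightarrow> P \<in> bounded_ops \<and> P o\<^sub>L P = P \<and> adj P = P"

definition is_op_inverse :: "('a::complex_hilbert_space \<Rightarrow>\<^sub>L 'a) \<Rightarrow> ('a \<Rightarrow>\<^sub>L 'a) \<Rightarrow> bool" where
  "is_op_inverse A B \<longleftrightarrow> A o\<^sub>L B = id_blinfun \<and> B o\<^sub>L A = id_blinfun"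

text \<open>The operators \<open>J\<close> with \<open>J = J\<^sup>* = J\<^sup>-\<^sup>1\<close>.\<close>

definition symmetries :: "('a::complex_hilbert_space \<Rightarrow>\<^sub>L 'a) set" where
  "symmetries = {J \<in> bounded_ops. J = adj J \<and> is_op_inverse J J}"

end

theory Submission
  imports Defs
begin

text \<open>
  Put \<open>A = P + P\<^sup>*\<close>. If a symmetry \<open>J\<close> satisfies \<open>J P \<ge> 0\<close>, then \<open>J P = P\<^sup>* J\<close>, so \<open>J\<close> commutes with
  \<open>A\<close> and \<open>J A = J P + J (J P) J \<ge> 0\<close>. As \<open>(J A)\<^sup>2 = A\<^sup>2\<close>, uniqueness of positive square roots gives
  \<open>J A = |A|\<close>. Hence all such \<open>J\<close> agree on the closure of the range of \<open>A\<close> and differ only on \<open>N(A)\<close>,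
  where the best choice is the identity. One such \<open>J\<close> is the sign of the invertible operator \<open>A - I\<close>;
  it is \<open>-I\<close> on \<open>N(A) = N(P) \<inter> N(P\<^sup>*)\<close>, so its positive eigenspace is the closure of the range of
  \<open>A\<^sup>+\<close>. In part (ii), the set is invariant under \<open>J \<mapsto> -J\<close>, so a maximum is a nonnegative symmetry,
  hence the identity.
\<close>

subsection \<open>Complex inner products\<close>

lemma cinner_add_right: "cinner x (y + z) = cinner x y + cinner x z"
  for x :: "'a::complex_hilbert_space"
  by (metis cinner_add_left cinner_commute complex_cnj_add)

lemma cinner_scaleC_right: "cinner x (c *\<^sub>C y) = cnj c * cinner x y"
  for x :: "'a::complex_hilbert_space"
  by (metis cinner_scaleC_left cinner_commute complex_cnj_mult)

lemma scaleC_one [simp]: "1 *\<^sub>C x = x" for x :: "'a::complex_hilbert_space"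
  using scaleC_scaleR[of 1 x] by simp

lemma scaleC_minus_one: "(-1) *\<^sub>C x = - x" for x :: "'a::complex_hilbert_space"
  using scaleC_scaleR[of "-1" x] by simp

lemma scaleC_zero_right [simp]: "c *\<^sub>C 0 = (0::'a::complex_hilbert_space)"
  using scaleC_add_right[of c "0::'a" 0] by simp

lemma scaleC_minus_right: "c *\<^sub>C (- x) = - (c *\<^sub>C x)" for x :: "'a::complex_hilbert_space"
  using scaleC_add_right[of c x "- x"] by (simp add: eq_neg_iff_add_eq_0 add.commute)

lemma scaleC_diff_right: "c *\<^sub>C (x - y) = c *\<^sub>C x - c *\<^sub>C y" for x :: "'a::complex_hilbert_space"
  using scaleC_add_right[of c x "- y"] by (simp add: scaleC_minus_right)

lemma scaleC_scaleR_commute: "c *\<^sub>C (r *\<^sub>R x) = r *\<^sub>R (c *\<^sub>C x)"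
  for x :: "'a::complex_hilbert_space"
  by (simp add: scaleC_scaleR[symmetric] scaleC_scaleC mult.commute)

lemma cinner_scaleR_left: "cinner (r *\<^sub>R x) y = of_real r * cinner x y"
  for x :: "'a::complex_hilbert_space"
  by (simp add: scaleC_scaleR[symmetric] cinner_scaleC_left)

lemma cinner_scaleR_right: "cinner x (r *\<^sub>R y) = of_real r * cinner x y"
  for x :: "'a::complex_hilbert_space"
  by (simp add: scaleC_scaleR[symmetric] cinner_scaleC_right)

lemma cinner_minus_left: "cinner (- x) y = - cinner x y"
  for x :: "'a::complex_hilbert_space"
  using cinner_scaleR_left[of "-1" x y] by simp

lemma cinner_minus_right: "cinner x (- y) = - cinner x y"
  for x :: "'a::complex_hilbert_space"
  using cinner_scaleR_right[of x "-1" y] by simp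

lemma cinner_zero_left [simp]: "cinner 0 (y::'a::complex_hilbert_space) = 0"
  using cinner_scaleR_left[of 0 0 y] by simp

lemma cinner_zero_right [simp]: "cinner (y::'a::complex_hilbert_space) 0 = 0"
  using cinner_scaleR_right[of y 0 0] by simp

lemma cinner_diff_left: "cinner (x - y) z = cinner x z - cinner y z"
  for x :: "'a::complex_hilbert_space"
  using cinner_add_left[of x "- y" z] by (simp add: cinner_minus_left)

lemma cinner_diff_right: "cinner x (y - z) = cinner x y - cinner x z"
  for x :: "'a::complex_hilbert_space"
  using cinner_add_right[of x y "- z"] by (simp add: cinner_minus_right)

lemmas cinner_simps = cinner_add_left cinner_add_right cinner_diff_left cinner_diff_right
  cinner_minus_left cinner_minus_right cinner_scaleR_left cinner_scaleR_right
  cinner_scaleC_left cinner_scaleC_right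

lemma Re_cinner_self: "Re (cinner x x) = (norm x)\<^sup>2" for x :: "'a::complex_hilbert_space"
  by (simp add: cinner_norm)

lemma cinner_self_eq_0: "cinner x x = 0 \<longleftrightarrow> x = 0" for x :: "'a::complex_hilbert_space"
  by (simp add: cinner_norm)

lemma cinner_eqI: "(\<And>y. cinner x y = cinner z y) \<Longrightarrow> x = z" for x :: "'a::complex_hilbert_space"
  using cinner_self_eq_0[of "x - z"] by (simp add: cinner_simps)

lemma cinner_eqI_right: "(\<And>y. cinner y x = cinner y z) \<Longrightarrow> x = z"
  for x :: "'a::complex_hilbert_space"
  using cinner_self_eq_0[of "x - z"] by (simp add: cinner_simps)

text \<open>The norm axioms of the class speak of real scalars only. For complex ones the claim is
  read off from \<open>cinner_norm\<close>, since \<open>c * cnj c\<close> is the squared modulus of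
  \<open>c\<close>.\<close>

lemma norm_scaleC: "norm (c *\<^sub>C x) = cmod c * norm x" for x :: "'a::complex_hilbert_space"
proof -
  have "complex_of_real ((norm (c *\<^sub>C x))\<^sup>2) = of_real ((cmod c * norm x)\<^sup>2)"
    unfolding cinner_norm[of x, symmetric] cinner_norm[of "c *\<^sub>C x", symmetric]
      power_mult_distrib of_real_mult complex_norm_square[of c]
    by (simp add: cinner_simps)
  then show ?thesis
    by (simp only: of_real_eq_iff power2_eq_iff_nonneg norm_ge_zero mult_nonneg_nonneg)
qed

lemma parallelogram:
  "(norm (x + y))\<^sup>2 + (norm (x - y))\<^sup>2 = 2 * (norm x)\<^sup>2 + 2 * (norm y)\<^sup>2"
  for x :: "'a::complex_hilbert_space"
  by (simp add: Re_cinner_self[symmetric] cinner_simps)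

lemma cinner_cauchy_schwarz: "cmod (cinner x y) \<le> norm x * norm y"
  for x :: "'a::complex_hilbert_space"
proof (cases "y = 0")
  case False
  \<comment> \<open>\<open>c\<close> is the coefficient of the projection of \<open>x\<close> onto
    the line through \<open>y\<close>. The inequality expresses that the remainder has nonnegative
    squared norm.\<close>
  define c where "c = cinner x y / of_real ((norm y)\<^sup>2)"
  have ny: "norm y > 0" using False by simp
  have "cinner (x - c *\<^sub>C y) (x - c *\<^sub>C y)
    = of_real ((norm x)\<^sup>2) - of_real ((cmod (cinner x y))\<^sup>2 / (norm y)\<^sup>2)"
  proof -
    have c: "c * of_real ((norm y)\<^sup>2) = cinner x y" using ny by (simp add: c_def)
    have "complex_of_real ((cmod (cinner x y))\<^sup>2 / (norm y)\<^sup>2) = c * cinner y x"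
      unfolding of_real_divide complex_norm_square by (simp add: c_def cinner_commute[of y x])
    moreover have "cinner (x - c *\<^sub>C y) (x - c *\<^sub>C y) = of_real ((norm x)\<^sup>2)
      - c * cinner y x - cnj c * (cinner x y - c * of_real ((norm y)\<^sup>2))"
      unfolding cinner_norm[symmetric] by (simp add: cinner_simps algebra_simps)
    ultimately show ?thesis by (simp only: c) simp
  qed
  then have "of_real ((norm (x - c *\<^sub>C y))\<^sup>2)
    = complex_of_real ((norm x)\<^sup>2 - (cmod (cinner x y))\<^sup>2 / (norm y)\<^sup>2)"
    by (simp add: cinner_norm)
  then have "(norm x)\<^sup>2 - (cmod (cinner x y))\<^sup>2 / (norm y)\<^sup>2 = (norm (x - c *\<^sub>C y))\<^sup>2"
    by (simp only: of_real_eq_iff)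
  then have "(norm x)\<^sup>2 - (cmod (cinner x y))\<^sup>2 / (norm y)\<^sup>2 \<ge> 0" by simp
  then have "(cmod (cinner x y))\<^sup>2 \<le> (norm x * norm y)\<^sup>2"
    using ny by (simp add: field_simps)
  then show ?thesis by (rule power2_le_imp_le) simp
qed simp

lemma bounded_linear_scaleC: "bounded_linear ((*\<^sub>C) c :: 'a::complex_hilbert_space \<Rightarrow> 'a)"
  by (rule bounded_linear_intro[where K = "cmod c"])
    (simp_all add: scaleC_add_right scaleC_scaleR_commute norm_scaleC)

lemma bounded_bilinear_cinner: "bounded_bilinear (cinner :: 'a::complex_hilbert_space \<Rightarrow> _)"
proof
  show "\<exists>K. \<forall>(a::'a) b. cmod (cinner a b) \<le> norm a * norm b * K"
    by (rule exI[of _ 1]) (simp add: cinner_cauchy_schwarz)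
qed (simp_all add: cinner_simps scaleR_conv_of_real)

text \<open>This rule and the next serve to show that sets cut out by equations, such as commutants,
  are closed.\<close>

lemmas continuous_on_scaleC [continuous_intros] =
  bounded_linear.continuous_on[OF bounded_linear_scaleC]

lemmas continuous_on_cinner [continuous_intros] =
  bounded_bilinear.continuous_on[OF bounded_bilinear_cinner]

subsection \<open>Orthogonal projections and adjoints\<close>

definition csubspace :: "'a::complex_hilbert_space set \<Rightarrow> bool" where
  "csubspace M \<longleftrightarrow> 0 \<in> M \<and> (\<forall>x\<in>M. \<forall>y\<in>M. x + y \<in> M) \<and> (\<forall>c. \<forall>x\<in>M. c *\<^sub>C x \<in> M)"

lemma csubspaceD:
  assumes "csubspace M"
  shows csubspace_0: "0 \<in> M"
    and csubspace_add: "x \<in> M \<Longrightarrow> y \<in> M \<Longrightarrow> x + y \<in> M"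
    and csubspace_scaleC: "x \<in> M \<Longrightarrow> c *\<^sub>C x \<in> M"
    and csubspace_scaleR: "x \<in> M \<Longrightarrow> r *\<^sub>R x \<in> M"
    and csubspace_diff: "x \<in> M \<Longrightarrow> y \<in> M \<Longrightarrow> x - y \<in> M"
proof -
  show "0 \<in> M" and add: "x \<in> M \<Longrightarrow> y \<in> M \<Longrightarrow> x + y \<in> M"
    and scaleC: "x \<in> M \<Longrightarrow> c *\<^sub>C x \<in> M" for x y c
    using assms by (auto simp: csubspace_def)
  show "x \<in> M \<Longrightarrow> r *\<^sub>R x \<in> M"
    using scaleC[of x "of_real r"] by (simp add: scaleC_scaleR)
  show "x \<in> M \<Longrightarrow> y \<in> M \<Longrightarrow> x - y \<in> M"
    using add[of x "(-1) *\<^sub>C y"] scaleC[of y "-1"] by (simp add: scaleC_minus_one)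
qed

lemma csubspace_closure:
  assumes "csubspace M" shows "csubspace (closure M)"
  unfolding csubspace_def
proof (intro conjI ballI allI)
  show "0 \<in> closure M" using assms csubspace_0 closure_subset by blast
next
  fix x y assume "x \<in> closure M" "y \<in> closure M"
  then obtain f g where "\<forall>n. f n \<in> M" "f \<longlonglongrightarrow> x" "\<forall>n. g n \<in> M" "g \<longlonglongrightarrow> y"
    unfolding closure_sequential by metis
  then show "x + y \<in> closure M"
    unfolding closure_sequential
    by (intro exI[of _ "\<lambda>n. f n + g n"]) (auto intro: tendsto_add csubspace_add[OF assms])
next
  fix c x assume "x \<in> closure M"
  then obtain f where "\<forall>n. f n \<in> M" "f \<longlonglongrightarrow> x"
    unfolding closure_sequential by metis
  then show "c *\<^sub>C x \<in> closure M"
    unfolding closure_sequential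
    by (intro exI[of _ "\<lambda>n. c *\<^sub>C f n"])
      (auto intro: bounded_linear.tendsto[OF bounded_linear_scaleC] csubspace_scaleC[OF assms])
qed

text \<open>A minimizing sequence is Cauchy: the midpoint of two terms lies in \<open>M\<close>, so
  its squared distance to \<open>x\<close> is at least \<open>d\<close>, and the parallelogram law
  then bounds the distance between the terms.\<close>

lemma ex_nearest_point:
  assumes M: "csubspace (M :: 'a::complex_hilbert_space set)" and cl: "closed M"
  shows "\<exists>m\<in>M. \<forall>y\<in>M. norm (x - m) \<le> norm (x - y)"
proof -
  have ne: "M \<noteq> {}" using csubspace_0[OF M] by auto
  define d where "d = (INF y\<in>M. (norm (x - y))\<^sup>2)"
  have bdd: "bdd_below ((\<lambda>y. (norm (x - y))\<^sup>2) ` M)" by (auto intro!: bdd_belowI[of _ 0])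
  have d_le: "d \<le> (norm (x - y))\<^sup>2" if "y \<in> M" for y
    unfolding d_def using bdd that by (rule cINF_lower)
  have "\<exists>y\<in>M. (norm (x - y))\<^sup>2 < d + 1 / real (Suc n)" for n
    using cINF_less_iff[OF ne bdd, of "d + 1 / real (Suc n)"] by (simp add: d_def)
  then obtain f where f: "f n \<in> M" "(norm (x - f n))\<^sup>2 < d + 1 / real (Suc n)" for n
    by metis
  have diff: "(norm (f n - f k))\<^sup>2 \<le> 2 / real (Suc n) + 2 / real (Suc k)" for n k
  proof -
    let ?mid = "(1/2) *\<^sub>R (f n + f k)"
    have "(x - f n) + (x - f k) = 2 *\<^sub>R (x - ?mid)" by (simp add: algebra_simps scaleR_2)
    moreover have "(x - f n) - (x - f k) = - (f n - f k)" by simp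
    ultimately have "4 * (norm (x - ?mid))\<^sup>2 + (norm (f n - f k))\<^sup>2
        = 2 * (norm (x - f n))\<^sup>2 + 2 * (norm (x - f k))\<^sup>2"
      using parallelogram[of "x - f n" "x - f k"]
      by (simp only: norm_minus_cancel norm_scaleR) (simp add: power_mult_distrib)
    moreover have "d \<le> (norm (x - ?mid))\<^sup>2"
      by (intro d_le csubspace_scaleR csubspace_add M f)
    ultimately show ?thesis using f(2)[of n] f(2)[of k] by simp
  qed
  have "Cauchy f"
  proof (rule metric_CauchyI)
    fix e :: real assume e: "e > 0"
    obtain n0 where n0: "inverse (real (Suc n0)) < e\<^sup>2 / 4"
      using reals_Archimedean[of "e\<^sup>2 / 4"] e by auto
    show "\<exists>N. \<forall>m\<ge>N. \<forall>n\<ge>N. dist (f m) (f n) < e"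
    proof (intro exI allI impI)
      fix m n assume mn: "m \<ge> n0" "n \<ge> n0"
      have "1 / real (Suc m) \<le> 1 / real (Suc n0)" "1 / real (Suc n) \<le> 1 / real (Suc n0)"
        using mn by (auto intro!: divide_left_mono)
      moreover have "1 / real (Suc n0) < e\<^sup>2 / 4" using n0 by (simp only: inverse_eq_divide)
      moreover have "(norm (f m - f n))\<^sup>2 \<le> 2 * (1 / real (Suc m)) + 2 * (1 / real (Suc n))"
        using diff[of m n] by simp
      ultimately have "(norm (f m - f n))\<^sup>2 < e\<^sup>2" by linarith
      then show "dist (f m) (f n) < e"
        using e by (simp add: dist_norm power2_less_imp_less)
    qed
  qed
  then obtain m where m: "f \<longlonglongrightarrow> m" using Cauchy_convergent_iff convergent_def by blast
  have mM: "m \<in> M" using cl m f(1) closed_sequentially by blast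
  have "(\<lambda>n. (norm (x - f n))\<^sup>2) \<longlonglongrightarrow> (norm (x - m))\<^sup>2"
    by (intro tendsto_intros m)
  moreover have "(\<lambda>n. d + 1 / real (Suc n)) \<longlonglongrightarrow> d + 0"
    using LIMSEQ_inverse_real_of_nat by (intro tendsto_intros) (simp add: inverse_eq_divide)
  ultimately have "(norm (x - m))\<^sup>2 \<le> d + 0"
    by (rule LIMSEQ_le) (use f(2) less_imp_le in blast)
  then have "norm (x - m) \<le> norm (x - y)" if "y \<in> M" for y
    using d_le[OF that] by (smt (verit) norm_ge_zero power2_le_imp_le)
  with mM show ?thesis by blast
qed

lemma ex_orthogonal_decomposition:
  assumes M: "csubspace (M :: 'a::complex_hilbert_space set)" and cl: "closed M"
  shows "\<exists>m\<in>M. \<forall>y\<in>M. cinner (x - m) y = 0"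
proof -
  obtain m where m: "m \<in> M" "\<And>y. y \<in> M \<Longrightarrow> norm (x - m) \<le> norm (x - y)"
    using ex_nearest_point[OF assms] by blast
  have "cinner (x - m) y = 0" if y: "y \<in> M" for y
  proof -
    define z where "z = x - m"
    define c where "c = cinner z y"
    \<comment> \<open>This choice gives \<open>t * (norm y)^2 <= 1\<close>, so the quadratic term of
      the perturbed squared distance is at most half of the linear one. The summand 1 also covers
      \<open>y = 0\<close>.\<close>
    define t where "t = 1 / ((norm y)\<^sup>2 + 1)"
    have pos: "(norm y)\<^sup>2 + 1 > 0" by (simp add: add_nonneg_pos)
    have "norm z \<le> norm (z - (of_real t * c) *\<^sub>C y)"
      using m(2)[of "m + (of_real t * c) *\<^sub>C y"] m(1) y
      by (simp add: z_def csubspace_add[OF M] csubspace_scaleC[OF M] algebra_simps)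
    then have "(norm z)\<^sup>2 \<le> (norm (z - (of_real t * c) *\<^sub>C y))\<^sup>2" by (simp add: power_mono)
    also have "\<dots> = (norm z)\<^sup>2 - 2 * t * (cmod c)\<^sup>2 + t\<^sup>2 * (cmod c)\<^sup>2 * (norm y)\<^sup>2"
    proof -
      have yz: "cinner y z = cnj c" unfolding c_def by (rule cinner_commute)
      show ?thesis
        unfolding Re_cinner_self[of z, symmetric] Re_cinner_self[of "z - _", symmetric]
        by (simp add: cinner_simps yz c_def[symmetric] cinner_norm[of y] cmod_power2 del: of_real_power)
          (simp add: power2_eq_square algebra_simps)
    qed
    finally have "2 * t * (cmod c)\<^sup>2 \<le> t * (cmod c)\<^sup>2 * (t * (norm y)\<^sup>2)"
      by (simp add: power2_eq_square algebra_simps)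
    also have "\<dots> \<le> t * (cmod c)\<^sup>2 * 1"
      using pos by (intro mult_left_mono) (auto simp: t_def field_simps)
    finally have "t * (cmod c)\<^sup>2 \<le> 0" by simp
    moreover have "t > 0" using pos by (simp add: t_def)
    ultimately have "(cmod c)\<^sup>2 \<le> 0" by (simp add: mult_le_0_iff)
    then show ?thesis by (simp add: c_def z_def)
  qed
  with m(1) show ?thesis by blast
qed

lemma bounded_opsD: "(A :: 'a::complex_hilbert_space \<Rightarrow>\<^sub>L 'a) \<in> bounded_ops \<Longrightarrow> A (c *\<^sub>C x) = c *\<^sub>C A x"
  by (simp add: bounded_ops_def)

text \<open>Discharges the description in \<open>orth_proj\<close>. The point of \<open>M\<close>
  with remainder orthogonal to \<open>M\<close> is unique, and this uniqueness makes the chosen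
  points depend linearly on \<open>x\<close>.\<close>

lemma orth_proj_correct:
  assumes M: "csubspace (M :: 'a::complex_hilbert_space set)" and cl: "closed M"
  shows "orth_proj M \<in> bounded_ops" "orth_proj M x \<in> M"
    and "y \<in> M \<Longrightarrow> cinner (x - orth_proj M x) y = 0"
proof -
  define p where "p x = (SOME m. m \<in> M \<and> (\<forall>y\<in>M. cinner (x - m) y = 0))" for x
  have p: "p x \<in> M" "y \<in> M \<Longrightarrow> cinner (x - p x) y = 0" for x y
    using someI_ex[of "\<lambda>m. m \<in> M \<and> (\<forall>y\<in>M. cinner (x - m) y = 0)"]
      ex_orthogonal_decomposition[OF M cl, of x] unfolding p_def by blast+
  have uniq: "m = p x" if "m \<in> M" "\<And>y. y \<in> M \<Longrightarrow> cinner (x - m) y = 0" for m x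
  proof -
    have "m - p x \<in> M" using M that(1) p(1) by (rule csubspace_diff)
    then have "cinner ((x - p x) - (x - m)) (m - p x) = 0"
      by (simp only: cinner_diff_left[of "x - p x" "x - m"] that(2) p(2)) simp
    then show ?thesis by (simp add: cinner_self_eq_0)
  qed
  have add: "p (x + y) = p x + p y" for x y
    by (rule uniq[symmetric])
      (use p(2)[of _ x] p(2)[of _ y] in \<open>simp_all add: csubspace_add[OF M] p(1) cinner_simps\<close>)
  have scaleC: "p (c *\<^sub>C x) = c *\<^sub>C p x" for c x
    by (rule uniq[symmetric])
      (use p(2)[of _ x] in \<open>simp_all add: csubspace_scaleC[OF M] p(1) cinner_simps\<close>)
  have norm: "norm (p x) \<le> norm x" for x
  proof -
    have "cinner x (p x) = cinner (p x) (p x)" using p(2)[OF p(1), of x x] by (simp add: cinner_simps)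
    then have "(norm (p x))\<^sup>2 \<le> norm x * norm (p x)"
      using cinner_cauchy_schwarz[of x "p x"] by (simp add: cinner_norm norm_power)
    then show ?thesis by (cases "norm (p x) = 0") (auto simp: power2_eq_square mult_le_cancel_right)
  qed
  have "bounded_linear p"
    by (rule bounded_linear_intro[where K = 1])
      (use norm in \<open>simp_all add: add scaleC scaleC_scaleR[symmetric]\<close>)
  then have app: "blinfun_apply (Blinfun p) = p" by (rule bounded_linear_Blinfun_apply)
  let ?spec = "\<lambda>Q :: 'a \<Rightarrow>\<^sub>L 'a. Q \<in> bounded_ops \<and> (\<forall>x. Q x \<in> M \<and> (\<forall>y\<in>M. cinner (x - Q x) y = 0))"
  have "?spec (Blinfun p)"
    using p by (simp add: app bounded_ops_def scaleC)
  moreover have "Q = Blinfun p" if "?spec Q" for Q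
    by (rule blinfun_eqI) (use that uniq in \<open>auto simp: app\<close>)
  ultimately have "?spec (orth_proj M)"
    unfolding orth_proj_def by (rule theI)
  then show "orth_proj M \<in> bounded_ops" "orth_proj M x \<in> M"
    "y \<in> M \<Longrightarrow> cinner (x - orth_proj M x) y = 0" by blast+
qed

section \<open>Riesz representation and existence of adjoints\<close>

lemma riesz_representation:
  fixes f :: "'a::complex_hilbert_space \<Rightarrow> complex"
  assumes "bounded_linear f" and scaleC: "\<And>c x. f (c *\<^sub>C x) = c * f x"
  shows "\<exists>z. \<forall>x. f x = cinner x z"
proof (cases "\<forall>x. f x = 0")
  case True
  then show ?thesis by (intro exI[of _ 0]) simp
next
  case False
  then obtain u where u: "f u \<noteq> 0" by blast
  interpret f: bounded_linear f by fact
  let ?K = "{x. f x = 0}"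
  have K: "csubspace ?K" by (simp add: csubspace_def f.add f.zero scaleC)
  have cl: "closed ?K"
    by (intro closed_Collect_eq f.continuous_on continuous_on_id continuous_on_const)
  obtain m where m: "f m = 0" "\<And>y. f y = 0 \<Longrightarrow> cinner (u - m) y = 0"
    using ex_orthogonal_decomposition[OF K cl, of u] by auto
  define w where "w = u - m"
  have fw: "f w \<noteq> 0" using u m(1) by (simp add: w_def f.diff)
  have nw: "cinner w w \<noteq> 0" using fw by (auto simp: cinner_self_eq_0 f.zero)
  \<comment> \<open>The vector \<open>w\<close> is orthogonal to the kernel of \<open>f\<close>,
    which contains \<open>f w\<close> times \<open>x\<close> minus \<open>f x\<close> times
    \<open>w\<close>. Conjugates appear because \<open>cinner\<close> is conjugate-linear in its
    second argument.\<close>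
  have "f x = cinner x ((cnj (f w) / cnj (cinner w w)) *\<^sub>C w)" for x
  proof -
    have "cinner w (f w *\<^sub>C x - f x *\<^sub>C w) = 0"
      unfolding w_def by (rule m(2)) (simp add: f.diff scaleC)
    then have "cnj (cinner w (f w *\<^sub>C x - f x *\<^sub>C w)) = 0" by simp
    then have "f w * cinner x w = f x * cinner w w"
      by (simp add: cinner_simps cinner_commute[of x w] cinner_norm)
    then show ?thesis using nw by (simp add: cinner_simps field_simps)
  qed
  then show ?thesis by blast
qed

lemma adj_eqI:
  fixes A :: "'a::complex_hilbert_space \<Rightarrow>\<^sub>L 'a"
  assumes "B \<in> bounded_ops" "\<And>x y. cinner (A x) y = cinner x (B y)"
  shows "adj A = B"
  unfolding adj_def
proof (rule the_equality)
  show "B \<in> bounded_ops \<and> (\<forall>x y. cinner (A x) y = cinner x (B y))" using assms by blast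
  fix B' :: "'a \<Rightarrow>\<^sub>L 'a" assume "B' \<in> bounded_ops \<and> (\<forall>x y. cinner (A x) y = cinner x (B' y))"
  then have "cinner x (B' y) = cinner x (B y)" for x y using assms(2)[of x y] by simp
  then show "B' = B" by (intro blinfun_eqI) (rule cinner_eqI_right)
qed

text \<open>Riesz representation for each fixed \<open>y\<close> yields the value
  \<open>b y\<close>. Boundedness of \<open>b\<close> follows by applying Cauchy-Schwarz to
  \<open>cinner (A (b x)) x\<close>, which is the squared norm of \<open>b x\<close>.\<close>

lemma ex_adjoint:
  fixes A :: "'a::complex_hilbert_space \<Rightarrow>\<^sub>L 'a"
  assumes A: "A \<in> bounded_ops"
  shows "\<exists>B\<in>bounded_ops. \<forall>x y. cinner (A x) y = cinner x (B y)"
proof -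
  have "\<exists>z. \<forall>x. cinner (A x) y = cinner x z" for y
  proof (rule riesz_representation)
    show "bounded_linear (\<lambda>x. cinner (A x) y)"
      by (rule bounded_linear_compose[OF bounded_bilinear.bounded_linear_left[OF bounded_bilinear_cinner]
          blinfun.bounded_linear_right])
    show "\<And>c x. cinner (A (c *\<^sub>C x)) y = c * cinner (A x) y"
      by (simp add: bounded_opsD[OF A] cinner_simps)
  qed
  then obtain b where b: "\<And>x y. cinner (A x) y = cinner x (b y)" by metis
  have "bounded_linear b"
  proof (rule bounded_linear_intro[where K = "norm A"])
    show "b (x + y) = b x + b y" "b (r *\<^sub>R x) = r *\<^sub>R b x" for x y r
      by (rule cinner_eqI_right, simp add: b[symmetric] cinner_simps)+
    show "norm (b x) \<le> norm x * norm A" for x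
    proof -
      have "(norm (b x))\<^sup>2 = cmod (cinner (b x) (b x))" by (simp add: cinner_norm norm_power)
      also have "\<dots> = cmod (cinner (A (b x)) x)" by (simp add: b)
      also have "\<dots> \<le> norm (A (b x)) * norm x" by (rule cinner_cauchy_schwarz)
      also have "\<dots> \<le> (norm A * norm (b x)) * norm x"
        by (intro mult_right_mono norm_blinfun) simp
      finally show ?thesis
        by (cases "norm (b x) = 0") (auto simp: power2_eq_square mult_ac)
    qed
  qed
  then have app: "blinfun_apply (Blinfun b) = b" by (rule bounded_linear_Blinfun_apply)
  have "b (c *\<^sub>C x) = c *\<^sub>C b x" for c x
    by (rule cinner_eqI_right) (simp add: b[symmetric] cinner_simps)
  then show ?thesis by (intro bexI[of _ "Blinfun b"]) (simp_all add: app b bounded_ops_def)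
qed

lemma
  fixes A :: "'a::complex_hilbert_space \<Rightarrow>\<^sub>L 'a"
  assumes "A \<in> bounded_ops"
  shows adj_bounded_ops: "adj A \<in> bounded_ops"
    and cinner_adj: "cinner (A x) y = cinner x (adj A y)"
proof -
  obtain B where "B \<in> bounded_ops" "\<And>x y. cinner (A x) y = cinner x (B y)"
    using ex_adjoint[OF assms] by blast
  moreover from this have "adj A = B" by (rule adj_eqI)
  ultimately show "adj A \<in> bounded_ops" "cinner (A x) y = cinner x (adj A y)" by simp_all
qed

subsection \<open>Self-adjoint and positive operators\<close>

lemma bounded_ops_closure:
  fixes A B :: "'a::complex_hilbert_space \<Rightarrow>\<^sub>L 'a"
  shows bounded_ops_id: "id_blinfun \<in> (bounded_ops :: ('a \<Rightarrow>\<^sub>L 'a) set)"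
    and bounded_ops_add: "A \<in> bounded_ops \<Longrightarrow> B \<in> bounded_ops \<Longrightarrow> A + B \<in> bounded_ops"
    and bounded_ops_diff: "A \<in> bounded_ops \<Longrightarrow> B \<in> bounded_ops \<Longrightarrow> A - B \<in> bounded_ops"
    and bounded_ops_minus: "A \<in> bounded_ops \<Longrightarrow> - A \<in> bounded_ops"
    and bounded_ops_scaleR: "A \<in> bounded_ops \<Longrightarrow> r *\<^sub>R A \<in> bounded_ops"
    and bounded_ops_compose: "A \<in> bounded_ops \<Longrightarrow> B \<in> bounded_ops \<Longrightarrow> A o\<^sub>L B \<in> bounded_ops"
  by (simp_all add: bounded_ops_def blinfun.bilinear_simps scaleC_add_right scaleC_diff_right
      scaleC_minus_right scaleC_scaleR_commute)

text \<open>Phrased by inner products, to avoid the description in \<open>adj\<close>; on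
  \<open>bounded_ops\<close> both notions agree by \<open>self_adjoint_iff_adj\<close>.\<close>

definition self_adjoint :: "('a::complex_hilbert_space \<Rightarrow>\<^sub>L 'a) \<Rightarrow> bool" where
  "self_adjoint A \<longleftrightarrow> (\<forall>x y. cinner (A x) y = cinner x (A y))"

lemma self_adjointD: "self_adjoint A \<Longrightarrow> cinner (A x) y = cinner x (A y)"
  by (simp add: self_adjoint_def)

lemma adj_self_adjoint:
  fixes A :: "'a::complex_hilbert_space \<Rightarrow>\<^sub>L 'a"
  assumes "A \<in> bounded_ops" "self_adjoint A"
  shows "adj A = A"
  using assms by (intro adj_eqI) (simp_all add: self_adjoint_def)

lemma self_adjoint_iff_adj:
  fixes A :: "'a::complex_hilbert_space \<Rightarrow>\<^sub>L 'a"
  assumes "A \<in> bounded_ops"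
  shows "self_adjoint A \<longleftrightarrow> adj A = A"
  using adj_self_adjoint[OF assms] cinner_adj[OF assms] by (auto simp: self_adjoint_def)

lemma Im_cinner_self_adjoint: "self_adjoint A \<Longrightarrow> Im (cinner (A x) x) = 0"
  using cinner_commute[of "A x" x] by (metis self_adjointD Reals_cnj_iff complex_is_Real_iff)

lemma op_nonneg_iff:
  assumes "self_adjoint A"
  shows "op_nonneg A \<longleftrightarrow> (\<forall>x. Re (cinner (A x) x) \<ge> 0)"
  using Im_cinner_self_adjoint[OF assms] by (simp add: op_nonneg_def complex_nonneg_Reals_iff)

lemma op_nonnegD: "op_nonneg A \<Longrightarrow> Re (cinner (A x) x) \<ge> 0" "op_nonneg A \<Longrightarrow> Im (cinner (A x) x) = 0"
  by (simp_all add: op_nonneg_def complex_nonneg_Reals_iff)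

text \<open>Polarization: the quadratic form is real at \<open>x + y\<close> and at
  \<open>x + i y\<close>. The first fact makes the imaginary parts of \<open>u\<close> and
  \<open>v\<close> opposite, the second makes their real parts equal.\<close>

lemma self_adjoint_if_op_nonneg:
  fixes A :: "'a::complex_hilbert_space \<Rightarrow>\<^sub>L 'a"
  assumes A: "A \<in> bounded_ops" and "op_nonneg A"
  shows "self_adjoint A"
  unfolding self_adjoint_def
proof (intro allI)
  fix x y
  define u where "u = cinner (A x) y"
  define v where "v = cinner (A y) x"
  have im: "Im (cinner (A z) z) = 0" for z
    using assms(2) by (rule op_nonnegD)
  have "Im (cinner (A (x + y)) (x + y)) = Im (u + v)"
    by (simp add: blinfun.bilinear_simps cinner_simps im u_def v_def)
  then have "Im (u + v) = 0" by (simp only: im)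
  moreover have "Im (cinner (A (x + \<i> *\<^sub>C y)) (x + \<i> *\<^sub>C y)) = Im (- \<i> * u + \<i> * v)"
    using im[of x] im[of y]
    by (simp add: blinfun.bilinear_simps bounded_opsD[OF A] cinner_simps u_def v_def)
  then have "Im (- \<i> * u + \<i> * v) = 0" by (simp only: im)
  ultimately have "u = cnj v" by (simp add: complex_eq_iff)
  then show "cinner (A x) y = cinner x (A y)"
    using cinner_commute[of x "A y"] by (simp add: u_def v_def)
qed

text \<open>
  Uniqueness of positive square roots without functional calculus: the difference \<open>X\<close> of two roots
  anticommutes with their sum \<open>Y\<close>, and \<open>-Y \<le> X \<le> Y\<close>. On a unit vector with \<open>\<parallel>X x\<parallel>\<close> close to
  \<open>m = \<parallel>X\<parallel>\<close>, the vector \<open>X (X x)\<close> is close to \<open>m\<^sup>2 x\<close>, so \<open>\<langle>Y X x, X x\<rangle> + m\<^sup>2 \<langle>Y x, x\<rangle>\<close>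
  is close to \<open>0\<close>; but by polarization it bounds \<open>2 m \<parallel>X x\<parallel>\<^sup>2\<close>.
\<close>

lemma zero_if_anticommutes_with_bound:
  fixes X Y :: "'a::complex_hilbert_space \<Rightarrow>\<^sub>L 'a"
  assumes X: "self_adjoint X"
    and anti: "\<And>x. X (Y x) = - Y (X x)"
    and bound: "\<And>x. \<bar>Re (cinner (X x) x)\<bar> \<le> Re (cinner (Y x) x)"
  shows "X = 0"
proof (rule ccontr)
  assume "X \<noteq> 0"
  define m where "m = norm X"
  \<comment> \<open>The summand 1 keeps \<open>K\<close> positive even for \<open>Y = 0\<close>. The
    number \<delta> below is a relative gap: by \<open>est\<close>, the squared norms of
    \<open>X x\<close> on unit vectors stay below \<open>m^2\<close> by this factor, contrary to
    \<open>m = norm X\<close>.\<close>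
  define K where "K = norm Y + 1"
  define \<delta> where "\<delta> = min (1/2) (m\<^sup>2 / K\<^sup>2)"
  have m: "m > 0" using \<open>X \<noteq> 0\<close> by (simp add: m_def)
  have K: "K > 0" by (simp add: K_def add_nonneg_pos)
  have \<delta>: "\<delta> > 0" "\<delta> \<le> 1/2" "\<delta> \<le> m\<^sup>2 / K\<^sup>2"
    unfolding \<delta>_def using m K by (simp_all only: min.cobounded1 min.cobounded2) simp
  have est: "(norm (X x))\<^sup>2 \<le> m\<^sup>2 * (1 - \<delta>)" if x: "norm x = 1" for x
  proof -
    define t where "t = (norm (X x))\<^sup>2"
    define w where "w = X (X x) - m\<^sup>2 *\<^sub>R x"
    have t_le: "t \<le> m\<^sup>2"
      unfolding t_def m_def using norm_blinfun[of X x] x by (intro power_mono) auto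
    have XXx: "cinner (X (X x)) x = of_real t"
      using self_adjointD[OF X, of "X x" x] cinner_norm[of "X x"] by (simp add: t_def)
    have XXx': "cinner x (X (X x)) = of_real t"
      using self_adjointD[OF X, of x "X x"] cinner_norm[of "X x"] by (simp add: t_def)
    have w2: "(norm w)\<^sup>2 = (norm (X (X x)))\<^sup>2 - 2 * m\<^sup>2 * t + m^4"
      unfolding Re_cinner_self[symmetric]
      by (simp add: w_def cinner_simps XXx XXx' cinner_norm[of x] x algebra_simps power_numeral_reduce)
    have "(norm (X (X x)))\<^sup>2 \<le> (m * norm (X x))\<^sup>2"
      unfolding m_def by (intro power_mono norm_blinfun) simp
    then have w_le: "(norm w)\<^sup>2 \<le> m\<^sup>2 * (m\<^sup>2 - t)"
      using w2 by (simp add: t_def power_mult_distrib algebra_simps power_numeral_reduce)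
    define a where "a = Re (cinner (Y (X x)) (X x)) + m\<^sup>2 * Re (cinner (Y x) x)"
    have "a = - Re (cinner (Y w) x)"
    proof -
      have "cinner (Y (X x)) (X x) = - cinner (Y (X (X x))) x"
        using self_adjointD[OF X, of "Y (X x)" x] anti[of "X x"] by (simp add: cinner_simps)
      then show ?thesis
        by (simp add: a_def w_def blinfun.bilinear_simps cinner_simps)
    qed
    also have "\<dots> \<le> cmod (cinner (Y w) x)" using abs_Re_le_cmod[of "cinner (Y w) x"] by linarith
    also have "\<dots> \<le> norm (Y w)" using cinner_cauchy_schwarz[of "Y w" x] x by simp
    also have "\<dots> \<le> K * norm w"
      using norm_blinfun[of Y w] by (simp add: K_def algebra_simps add_increasing)
    finally have a_le: "a \<le> K * norm w" .
    have "4 * m * t = Re (cinner (X (m *\<^sub>R x + X x)) (m *\<^sub>R x + X x))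
        - Re (cinner (X (m *\<^sub>R x - X x)) (m *\<^sub>R x - X x))"
      using cinner_norm[of "X x"] XXx
      by (simp add: blinfun.bilinear_simps cinner_simps t_def algebra_simps)
    also have "\<dots> \<le> Re (cinner (Y (m *\<^sub>R x + X x)) (m *\<^sub>R x + X x))
        + Re (cinner (Y (m *\<^sub>R x - X x)) (m *\<^sub>R x - X x))"
      using bound[of "m *\<^sub>R x + X x"] bound[of "m *\<^sub>R x - X x"] by linarith
    also have "\<dots> = 2 * a"
      by (simp add: a_def blinfun.bilinear_simps cinner_simps power2_eq_square algebra_simps)
    finally have "2 * m * t \<le> K * norm w" using a_le by linarith
    moreover have "0 \<le> 2 * m * t" using m by (simp add: t_def)
    ultimately have "(2 * m * t)\<^sup>2 \<le> (K * norm w)\<^sup>2" by (rule power_mono)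
    also have "\<dots> \<le> K\<^sup>2 * (m\<^sup>2 * (m\<^sup>2 - t))"
      unfolding power_mult_distrib using w_le by (intro mult_left_mono) auto
    finally have "m\<^sup>2 * (4 * t\<^sup>2) \<le> m\<^sup>2 * (K\<^sup>2 * (m\<^sup>2 - t))"
      by (simp add: power_mult_distrib algebra_simps)
    then have key: "4 * t\<^sup>2 \<le> K\<^sup>2 * (m\<^sup>2 - t)" using m by simp
    \<comment> \<open>A value \<open>t\<close> of at most half of \<open>m^2\<close> is covered by
      the bound 1/2 on \<delta>. For larger \<open>t\<close>, the left side of \<open>key\<close>
      exceeds \<open>m^4\<close>, which keeps \<open>t\<close> away from \<open>m^2\<close>.\<close>
    show ?thesis
    proof (cases "t \<le> m\<^sup>2 / 2")
      case True
      have "m\<^sup>2 / 2 \<le> m\<^sup>2 * (1 - \<delta>)"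
        using mult_left_mono[of "1/2" "1 - \<delta>" "m\<^sup>2"] \<delta> by simp
      then show ?thesis using True by (simp add: t_def)
    next
      case False
      then have "(m\<^sup>2 / 2)\<^sup>2 \<le> t\<^sup>2" by (intro power_mono) auto
      then have "m^4 \<le> K\<^sup>2 * (m\<^sup>2 - t)"
        using key by (simp add: power_divide power_mult[symmetric])
      then have "m\<^sup>2 * (m\<^sup>2 / K\<^sup>2) \<le> m\<^sup>2 - t"
        using K by (simp add: field_simps power_numeral_reduce)
      moreover have "m\<^sup>2 * \<delta> \<le> m\<^sup>2 * (m\<^sup>2 / K\<^sup>2)" by (intro mult_left_mono \<delta>) simp
      ultimately show ?thesis by (simp add: t_def algebra_simps)
    qed
  qed
  have "norm X \<le> m * sqrt (1 - \<delta>)"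
  proof (rule norm_blinfun_bound)
    show "0 \<le> m * sqrt (1 - \<delta>)" using m \<delta> by simp
    fix x
    show "norm (X x) \<le> m * sqrt (1 - \<delta>) * norm x"
    proof (cases "x = 0")
      case False
      define u where "u = (1 / norm x) *\<^sub>R x"
      have u: "norm u = 1" and xu: "x = norm x *\<^sub>R u" using False by (simp_all add: u_def)
      have "norm (X u) = sqrt ((norm (X u))\<^sup>2)" by simp
      also have "\<dots> \<le> sqrt (m\<^sup>2 * (1 - \<delta>))" by (intro real_sqrt_le_mono est u)
      also have "\<dots> = m * sqrt (1 - \<delta>)" using m by (simp add: real_sqrt_mult)
      finally have "norm x * norm (X u) \<le> norm x * (m * sqrt (1 - \<delta>))" by (intro mult_left_mono) auto
      moreover have "norm (X x) = norm x * norm (X u)"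
        by (subst xu) (simp add: blinfun.bilinear_simps)
      ultimately show ?thesis by (simp add: mult.commute)
    qed simp
  qed
  also have "\<dots> < m * 1" using m \<delta> by (intro mult_strict_left_mono) (simp_all add: real_sqrt_lt_1_iff)
  finally show False by (simp add: m_def)
qed

lemma positive_sqrt_unique:
  fixes A B :: "'a::complex_hilbert_space \<Rightarrow>\<^sub>L 'a"
  assumes A: "A \<in> bounded_ops" "op_nonneg A" and B: "B \<in> bounded_ops" "op_nonneg B"
    and eq: "A o\<^sub>L A = B o\<^sub>L B"
  shows "A = B"
proof -
  have sa: "self_adjoint A" "self_adjoint B" using A B by (simp_all add: self_adjoint_if_op_nonneg)
  have eq': "A (A x) = B (B x)" for x
    using arg_cong[OF eq, of "\<lambda>T. blinfun_apply T x"] by simp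
  have "A - B = 0"
  proof (rule zero_if_anticommutes_with_bound)
    show "self_adjoint (A - B)"
      using sa by (simp add: self_adjoint_def blinfun.bilinear_simps cinner_simps)
    show "(A - B) ((A + B) x) = - (A + B) ((A - B) x)" for x
      by (simp add: blinfun.bilinear_simps eq')
    show "\<bar>Re (cinner ((A - B) x) x)\<bar> \<le> Re (cinner ((A + B) x) x)" for x
      using op_nonnegD(1)[OF A(2), of x] op_nonnegD(1)[OF B(2), of x]
      by (simp add: blinfun.bilinear_simps cinner_simps)
  qed
  then show ?thesis by simp
qed

text \<open>Reduces computing an absolute value to exhibiting a positive square root. It is applied
  with the candidate \<open>J o\<^sub>L A\<close> for a symmetry \<open>J\<close>.\<close>

lemma op_abs_eqI:
  fixes A B :: "'a::complex_hilbert_space \<Rightarrow>\<^sub>L 'a"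
  assumes "B \<in> bounded_ops" "op_nonneg B" "B o\<^sub>L B = adj A o\<^sub>L A"
  shows "op_abs A = B"
  unfolding op_abs_def
proof (rule the_equality)
  show "B' = B" if "B' \<in> bounded_ops \<and> op_nonneg B' \<and> B' o\<^sub>L B' = adj A o\<^sub>L A" for B'
    by (rule positive_sqrt_unique) (use that assms in auto)
qed (use assms in blast)

subsection \<open>Inverse square roots\<close>

text \<open>
  The fixed point equations \<open>Y = (T + Y\<^sup>2) / 2\<close> for \<open>Y = I - (I - T)\<^sup>1\<^sup>/\<^sup>2\<close> and \<open>Z = I + Y Z\<close> for
  \<open>Z = (I - Y)\<^sup>-\<^sup>1\<close> are solved inside a closed set of operators which commute with everything that
  commutes with \<open>T\<close>.
\<close>

definition sa_bicommutant :: "('a::complex_hilbert_space \<Rightarrow>\<^sub>L 'a) \<Rightarrow> ('a \<Rightarrow>\<^sub>L 'a) set" where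
  "sa_bicommutant T = {Z \<in> bounded_ops. self_adjoint Z \<and>
     (\<forall>D :: 'a \<Rightarrow>\<^sub>L 'a. (\<forall>x. D (T x) = T (D x)) \<longrightarrow> (\<forall>x. D (Z x) = Z (D x)))}"

lemma sa_bicommutantD:
  fixes D :: "'a::complex_hilbert_space \<Rightarrow>\<^sub>L 'a"
  assumes "Z \<in> sa_bicommutant T"
  shows "Z \<in> bounded_ops" "self_adjoint Z" "(\<And>x. D (T x) = T (D x)) \<Longrightarrow> D (Z x) = Z (D x)"
  using assms by (auto simp: sa_bicommutant_def)

text \<open>Since \<open>T\<close> commutes with itself, \<open>Y\<close> commutes with
  \<open>T\<close>, so \<open>Y\<close> may be taken as the test operator \<open>D\<close> for
  \<open>Z\<close>. This is what keeps products self-adjoint.\<close>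

lemma sa_bicommutant_commute:
  fixes T :: "'a::complex_hilbert_space \<Rightarrow>\<^sub>L 'a"
  assumes Y: "Y \<in> sa_bicommutant T" and Z: "Z \<in> sa_bicommutant T"
  shows "Y (Z x) = Z (Y x)"
proof (rule sa_bicommutantD(3)[OF Z])
  show "Y (T x) = T (Y x)" for x
    using sa_bicommutantD(3)[OF Y, of T] by simp
qed

lemma sa_bicommutant_closure:
  fixes Y Z :: "'a::complex_hilbert_space \<Rightarrow>\<^sub>L 'a"
  assumes Y: "Y \<in> sa_bicommutant T" and Z: "Z \<in> sa_bicommutant T"
  shows sa_bicommutant_compose: "Y o\<^sub>L Z \<in> sa_bicommutant T"
    and sa_bicommutant_add: "Y + Z \<in> sa_bicommutant T"
    and sa_bicommutant_scaleR: "r *\<^sub>R Z \<in> sa_bicommutant T"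
proof -
  note ops = sa_bicommutantD(1)[OF Y] sa_bicommutantD(1)[OF Z]
  note sa = sa_bicommutantD(2)[OF Y] sa_bicommutantD(2)[OF Z]
  have comm: "D (Y x) = Y (D x)" "D (Z x) = Z (D x)" if "\<And>x. D (T x) = T (D x)"
    for D :: "'a \<Rightarrow>\<^sub>L 'a" and x
    using that by (rule sa_bicommutantD(3)[OF Y], rule sa_bicommutantD(3)[OF Z])
  show "Y o\<^sub>L Z \<in> sa_bicommutant T"
    unfolding sa_bicommutant_def
  proof (intro CollectI conjI allI impI)
    show "self_adjoint (Y o\<^sub>L Z)"
      using sa by (simp add: self_adjoint_def sa_bicommutant_commute[OF Y Z])
    fix D :: "'a \<Rightarrow>\<^sub>L 'a" and x assume "\<forall>x. D (T x) = T (D x)"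
    then show "D ((Y o\<^sub>L Z) x) = (Y o\<^sub>L Z) (D x)"
      using comm[of D] by (simp)
  qed (simp add: ops bounded_ops_compose)
  show "Y + Z \<in> sa_bicommutant T"
    unfolding sa_bicommutant_def
  proof (intro CollectI conjI allI impI)
    show "self_adjoint (Y + Z)"
      using sa by (simp add: self_adjoint_def blinfun.bilinear_simps cinner_simps)
    fix D :: "'a \<Rightarrow>\<^sub>L 'a" and x assume "\<forall>x. D (T x) = T (D x)"
    then show "D ((Y + Z) x) = (Y + Z) (D x)"
      using comm[of D] by (simp add: blinfun.bilinear_simps)
  qed (simp add: ops bounded_ops_add)
  show "r *\<^sub>R Z \<in> sa_bicommutant T"
    unfolding sa_bicommutant_def
  proof (intro CollectI conjI allI impI)
    show "self_adjoint (r *\<^sub>R Z)"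
      using sa by (simp add: self_adjoint_def blinfun.bilinear_simps cinner_simps)
    fix D :: "'a \<Rightarrow>\<^sub>L 'a" and x assume "\<forall>x. D (T x) = T (D x)"
    then show "D ((r *\<^sub>R Z) x) = (r *\<^sub>R Z) (D x)"
      using comm[of D] by (simp add: blinfun.bilinear_simps)
  qed (simp add: ops bounded_ops_scaleR)
qed

lemma id_in_sa_bicommutant: "id_blinfun \<in> sa_bicommutant T"
  by (simp add: sa_bicommutant_def bounded_ops_id self_adjoint_def)

text \<open>Each membership condition equates two continuous functions of \<open>Z\<close>.
  Closedness supplies the completeness required by the Banach fixed point theorem.\<close>

lemma closed_sa_bicommutant: "closed (sa_bicommutant (T :: 'a::complex_hilbert_space \<Rightarrow>\<^sub>L 'a))"
proof -
  have eq: "sa_bicommutant T = (\<Inter>c. \<Inter>x. {Z :: 'a \<Rightarrow>\<^sub>L 'a. Z (c *\<^sub>C x) = c *\<^sub>C Z x})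
      \<inter> (\<Inter>x. \<Inter>y. {Z :: 'a \<Rightarrow>\<^sub>L 'a. cinner (Z x) y = cinner x (Z y)})
      \<inter> (\<Inter>D\<in>{D :: 'a \<Rightarrow>\<^sub>L 'a. \<forall>x. D (T x) = T (D x)}. \<Inter>x. {Z :: 'a \<Rightarrow>\<^sub>L 'a. blinfun_apply D (Z x) = Z (D x)})"
    by (auto simp: sa_bicommutant_def bounded_ops_def self_adjoint_def)
  show ?thesis unfolding eq
    by (intro closed_Int closed_INT ballI closed_Collect_eq continuous_intros)
qed

lemma ex_inverse_sqrt_near_id:
  fixes T :: "'a::complex_hilbert_space \<Rightarrow>\<^sub>L 'a"
  assumes T: "T \<in> sa_bicommutant T" and less: "norm T < 1"
  shows "\<exists>R \<in> sa_bicommutant T. op_nonneg R \<and> (\<forall>x. R (R (x - T x)) = x)"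
proof -
  define q where "q = norm T"
  have q: "0 \<le> q" "q < 1" using less by (simp_all add: q_def)
  \<comment> \<open>The ball of radius \<open>q\<close> is invariant because
    \<open>(q + q^2) / 2 <= q\<close>, and on it the map contracts with constant
    \<open>q\<close>.\<close>
  have "\<exists>!Y\<in>sa_bicommutant T \<inter> cball 0 q. (1/2) *\<^sub>R (T + (Y o\<^sub>L Y)) = Y"
  proof (rule Banach_fix)
    show "complete (sa_bicommutant T \<inter> cball 0 q)"
      by (simp add: complete_eq_closed closed_Int closed_sa_bicommutant)
    show "sa_bicommutant T \<inter> cball 0 q \<noteq> {}" using T by (auto simp: q_def)
    show "(\<lambda>Y. (1/2) *\<^sub>R (T + (Y o\<^sub>L Y))) ` (sa_bicommutant T \<inter> cball 0 q) \<subseteq> sa_bicommutant T \<inter> cball 0 q"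
    proof (intro image_subsetI IntI)
      fix Y assume Y: "Y \<in> sa_bicommutant T \<inter> cball 0 q"
      then show "(1/2) *\<^sub>R (T + (Y o\<^sub>L Y)) \<in> sa_bicommutant T"
        using T by (auto intro!: sa_bicommutant_closure)
      have "norm (T + (Y o\<^sub>L Y)) \<le> norm T + norm Y * norm Y"
        by (intro norm_triangle_le add_left_mono norm_blinfun_compose)
      also have "\<dots> \<le> q + q * 1"
        using Y q by (intro add_mono mult_mono) (auto simp: q_def)
      finally show "(1/2) *\<^sub>R (T + (Y o\<^sub>L Y)) \<in> cball 0 q" by simp
    qed
    show "dist ((1/2) *\<^sub>R (T + (Y o\<^sub>L Y))) ((1/2) *\<^sub>R (T + (Z o\<^sub>L Z))) \<le> q * dist Y Z"
      if "Y \<in> sa_bicommutant T \<inter> cball 0 q" "Z \<in> sa_bicommutant T \<inter> cball 0 q" for Y Z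
    proof -
      from that have YZ: "norm Y \<le> q" "norm Z \<le> q" by auto
      have "(1/2) *\<^sub>R (T + (Y o\<^sub>L Y)) - (1/2) *\<^sub>R (T + (Z o\<^sub>L Z))
          = (1/2) *\<^sub>R ((Y o\<^sub>L (Y - Z)) + ((Y - Z) o\<^sub>L Z))"
        by (rule blinfun_eqI) (simp add: blinfun.bilinear_simps algebra_simps)
      then have "dist ((1/2) *\<^sub>R (T + (Y o\<^sub>L Y))) ((1/2) *\<^sub>R (T + (Z o\<^sub>L Z)))
          = norm ((Y o\<^sub>L (Y - Z)) + ((Y - Z) o\<^sub>L Z)) / 2"
        by (simp add: dist_norm)
      also have "\<dots> \<le> (norm Y * norm (Y - Z) + norm (Y - Z) * norm Z) / 2"
        by (intro divide_right_mono norm_triangle_le add_mono norm_blinfun_compose) simp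
      also have "\<dots> \<le> (q * norm (Y - Z) + norm (Y - Z) * q) / 2"
        by (intro divide_right_mono add_mono mult_mono YZ) (auto simp: q)
      finally show ?thesis
        by (simp add: dist_norm mult.commute)
    qed
  qed (use q in auto)
  then obtain Y where Y: "Y \<in> sa_bicommutant T" "norm Y \<le> q"
    and Y_fix: "(1/2) *\<^sub>R (T + (Y o\<^sub>L Y)) = Y" by auto
  \<comment> \<open>In operator terms, the square of \<open>I - Y\<close> is
    \<open>I - T\<close>.\<close>
  have sqrt: "(x - Y x) - Y (x - Y x) = x - T x" for x
  proof -
    have "2 *\<^sub>R Y x = 2 *\<^sub>R ((1/2) *\<^sub>R (T + (Y o\<^sub>L Y))) x" by (simp only: Y_fix)
    then have "2 *\<^sub>R Y x = T x + Y (Y x)" by (simp add: blinfun.bilinear_simps)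
    then show ?thesis by (simp add: blinfun.bilinear_simps scaleR_2 algebra_simps)
  qed
  have "\<exists>!Z\<in>sa_bicommutant T. id_blinfun + (Y o\<^sub>L Z) = Z"
  proof (rule Banach_fix)
    show "complete (sa_bicommutant T)" by (simp add: complete_eq_closed closed_sa_bicommutant)
    show "sa_bicommutant T \<noteq> {}" using T by auto
    show "(\<lambda>Z. id_blinfun + (Y o\<^sub>L Z)) ` sa_bicommutant T \<subseteq> sa_bicommutant T"
      by (auto intro!: sa_bicommutant_closure Y id_in_sa_bicommutant)
    show "dist (id_blinfun + (Y o\<^sub>L W)) (id_blinfun + (Y o\<^sub>L Z)) \<le> q * dist W Z" for W Z
    proof -
      have "id_blinfun + (Y o\<^sub>L W) - (id_blinfun + (Y o\<^sub>L Z)) = Y o\<^sub>L (W - Z)"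
        by (rule blinfun_eqI) (simp add: blinfun.bilinear_simps)
      then have "dist (id_blinfun + (Y o\<^sub>L W)) (id_blinfun + (Y o\<^sub>L Z)) \<le> norm Y * norm (W - Z)"
        by (simp only: dist_norm norm_blinfun_compose)
      also have "\<dots> \<le> q * dist W Z" unfolding dist_norm by (intro mult_right_mono Y) simp
      finally show ?thesis .
    qed
  qed (use q in auto)
  then obtain R where R: "R \<in> sa_bicommutant T" and R_fix: "id_blinfun + (Y o\<^sub>L R) = R" by auto
  have R_left: "R x - Y (R x) = x" for x
    using arg_cong[OF R_fix, of "\<lambda>T. blinfun_apply T x"]
    by (simp add: blinfun.bilinear_simps algebra_simps)
  \<comment> \<open>The fixed point equation gave a right inverse of \<open>I - Y\<close>;
    commutation of \<open>R\<close> with \<open>Y\<close> makes it a left inverse too.\<close>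
  then have R_right: "R (x - Y x) = x" for x
    by (simp add: blinfun.bilinear_simps sa_bicommutant_commute[OF R Y(1)])
  have "op_nonneg R"
    unfolding op_nonneg_iff[OF sa_bicommutantD(2)[OF R]]
  proof
    fix x
    \<comment> \<open>Substituting \<open>x = y - Y y\<close> turns the form of \<open>R\<close> at
      \<open>x\<close> into that of \<open>I - Y\<close> at \<open>y\<close>, which is nonnegative
      because \<open>norm Y < 1\<close>.\<close>
    define y where "y = R x"
    have x: "x = y - Y y" by (simp add: y_def R_left)
    have "cmod (cinner y (Y y)) \<le> norm y * (norm Y * norm y)"
      using cinner_cauchy_schwarz[of y "Y y"] mult_left_mono[OF norm_blinfun[of Y y], of "norm y"]
      by simp
    also have "\<dots> \<le> norm y * (1 * norm y)"
      using Y q by (intro mult_left_mono mult_right_mono) auto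
    finally have "Re (cinner y (Y y)) \<le> (norm y)\<^sup>2"
      using complex_Re_le_cmod[of "cinner y (Y y)"] by (simp add: power2_eq_square)
    then have "Re (cinner y x) \<ge> 0"
      unfolding x by (simp add: cinner_simps Re_cinner_self)
    then show "Re (cinner (R x) x) \<ge> 0" by (simp add: y_def)
  qed
  moreover have "R (R (x - T x)) = x" for x
    by (simp add: sqrt[symmetric] R_right)
  ultimately show ?thesis using R by blast
qed

text \<open>As \<open>B\<close> is skew-adjoint, \<open>S\<close> is \<open>I\<close> plus the
  positive operator \<open>-B^2\<close>. A suitable rescaling brings \<open>S\<close> close enough
  to the identity for \<open>ex_inverse_sqrt_near_id\<close>.\<close>

lemma ex_inverse_sqrt:
  fixes S B :: "'a::complex_hilbert_space \<Rightarrow>\<^sub>L 'a"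
  assumes B: "B \<in> bounded_ops" "\<And>x y. cinner (B x) y = - cinner x (B y)"
    and S: "\<And>x. S x = x - B (B x)"
  shows "\<exists>R \<in> sa_bicommutant S. op_nonneg R \<and> (\<forall>x. R (R (S x)) = x)"
proof -
  \<comment> \<open>With \<open>M = k + 1\<close>, \<open>T\<close> equals \<open>k / M\<close>
    times \<open>I + B^2 / k\<close>. The latter is a contraction since \<open>k\<close> dominates
    the squared norm of \<open>B\<close>, so \<open>norm T <= k / M < 1\<close>.\<close>
  define k where "k = (norm B)\<^sup>2 + 1"
  define M where "M = k + 1"
  define T where "T = id_blinfun - (1 / M) *\<^sub>R S"
  have pos: "(norm B)\<^sup>2 + 1 > 0" by (rule add_nonneg_pos) simp_all
  have k: "k > 0" "M > 1" using pos by (simp_all add: k_def M_def)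
  have S_bd: "S \<in> bounded_ops"
    using B(1) by (simp add: bounded_ops_def S scaleC_diff_right)
  have T_sa: "self_adjoint T"
    using B(2) by (simp add: self_adjoint_def T_def blinfun.bilinear_simps S cinner_simps)
  have T: "T \<in> sa_bicommutant T"
    using T_sa by (simp add: sa_bicommutant_def) (simp add: T_def S_bd bounded_ops_closure)
  have B_norm: "(norm (B x))\<^sup>2 \<le> k * (norm x)\<^sup>2" for x
  proof -
    have "(norm (B x))\<^sup>2 \<le> (norm B * norm x)\<^sup>2" by (intro power_mono norm_blinfun) simp
    also have "\<dots> \<le> k * (norm x)\<^sup>2"
      unfolding power_mult_distrib k_def by (intro mult_right_mono) simp_all
    finally show ?thesis .
  qed
  have contr: "norm (x + (1/k) *\<^sub>R B (B x)) \<le> norm x" for x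
  proof -
    have BB: "Re (cinner (B (B x)) x) = - (norm (B x))\<^sup>2" "Re (cinner x (B (B x))) = - (norm (B x))\<^sup>2"
      using B(2)[of "B x" x] B(2)[of x "B x"] Re_cinner_self[of "B x"] by simp_all
    have "(norm (x + (1/k) *\<^sub>R B (B x)))\<^sup>2
        = (norm x)\<^sup>2 - 2 / k * (norm (B x))\<^sup>2 + (1/k)\<^sup>2 * (norm (B (B x)))\<^sup>2"
      unfolding Re_cinner_self[of x, symmetric] Re_cinner_self[of "x + _", symmetric]
      by (simp add: cinner_simps BB Re_cinner_self) (use k in \<open>simp add: power2_eq_square field_simps\<close>)
    also have "\<dots> \<le> (norm x)\<^sup>2 - 2 / k * (norm (B x))\<^sup>2 + (1/k)\<^sup>2 * (k * (norm (B x))\<^sup>2)"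
      by (intro add_left_mono mult_left_mono B_norm) simp
    also have "\<dots> \<le> (norm x)\<^sup>2" using k by (simp add: power2_eq_square field_simps)
    finally show ?thesis by (rule power2_le_imp_le) simp
  qed
  have "norm T \<le> k / M"
  proof (rule norm_blinfun_bound)
    show "0 \<le> k / M" using k by simp
    fix x
    have "T x = (k / M) *\<^sub>R (x + (1/k) *\<^sub>R B (B x))"
    proof -
      have "(k / M) *\<^sub>R (x + (1/k) *\<^sub>R B (B x)) = (k / M) *\<^sub>R x + (1 / M) *\<^sub>R B (B x)"
        using k by (simp add: scaleR_add_right)
      moreover have "k / M = 1 - 1 / M" using k by (simp add: M_def field_simps)
      ultimately show ?thesis
        by (simp only: T_def blinfun.bilinear_simps S) (simp add: algebra_simps)
    qed
    then have "norm (T x) = (k / M) * norm (x + (1/k) *\<^sub>R B (B x))"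
      using k by simp
    also have "\<dots> \<le> (k / M) * norm x" using k by (intro mult_left_mono contr) simp
    finally show "norm (T x) \<le> k / M * norm x" .
  qed
  also have "\<dots> < 1" using k by (simp add: M_def)
  finally obtain R where R: "R \<in> sa_bicommutant T" "op_nonneg R" "\<And>x. R (R (x - T x)) = x"
    using ex_inverse_sqrt_near_id[OF T] by blast
  \<comment> \<open>\<open>T\<close> is an affine function of \<open>S\<close>, so whatever commutes
    with \<open>S\<close> commutes with \<open>T\<close>.\<close>
  have "sa_bicommutant T \<subseteq> sa_bicommutant S"
    by (auto simp: sa_bicommutant_def T_def blinfun.bilinear_simps)
  with R(1) have R_S: "R \<in> sa_bicommutant S" by blast
  \<comment> \<open>Since \<open>I - T\<close> is \<open>S / M\<close>, the factor
    \<open>1 / M\<close> is split evenly between the two copies of \<open>R\<close>.\<close>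
  define r where "r = sqrt (1 / M)"
  have r: "r \<ge> 0" "r * r = 1 / M" using k by (simp_all add: r_def)
  show ?thesis
  proof (intro bexI conjI allI)
    show "r *\<^sub>R R \<in> sa_bicommutant S" by (rule sa_bicommutant_scaleR[OF R_S R_S])
    show "op_nonneg (r *\<^sub>R R)"
      using R(2) r(1) by (auto simp: op_nonneg_def complex_nonneg_Reals_iff blinfun.bilinear_simps cinner_simps)
    show "(r *\<^sub>R R) ((r *\<^sub>R R) (S x)) = x" for x
      using R(3)[of x] by (simp add: blinfun.bilinear_simps r T_def)
  qed
qed

subsection \<open>Symmetries\<close>

lemma symmetriesI:
  fixes J :: "'a::complex_hilbert_space \<Rightarrow>\<^sub>L 'a"
  assumes "J \<in> bounded_ops" "self_adjoint J" "\<And>x. J (J x) = x"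
  shows "J \<in> symmetries"
proof -
  have "J o\<^sub>L J = id_blinfun" by (rule blinfun_eqI) (simp add: assms(3))
  then show ?thesis using assms(1,2) by (simp add: symmetries_def is_op_inverse_def adj_self_adjoint)
qed

lemma symmetriesD:
  fixes J :: "'a::complex_hilbert_space \<Rightarrow>\<^sub>L 'a"
  assumes "J \<in> symmetries"
  shows "J \<in> bounded_ops" "self_adjoint J" "J (J x) = x"
proof -
  show ops: "J \<in> bounded_ops" using assms by (simp add: symmetries_def)
  have "adj J = J" using assms by (simp add: symmetries_def)
  then show "self_adjoint J" by (simp add: self_adjoint_iff_adj[OF ops])
  have "J o\<^sub>L J = id_blinfun" using assms by (simp add: symmetries_def is_op_inverse_def)
  from arg_cong[OF this, of "\<lambda>T. blinfun_apply T x"] show "J (J x) = x" by simp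
qed

lemma symmetry_minus:
  fixes J :: "'a::complex_hilbert_space \<Rightarrow>\<^sub>L 'a"
  assumes "J \<in> symmetries" shows "- J \<in> symmetries"
  using symmetriesD[OF assms]
  by (intro symmetriesI)
    (simp_all add: bounded_ops_minus self_adjoint_def cinner_simps blinfun.bilinear_simps)

lemma id_symmetry: "id_blinfun \<in> symmetries"
  by (rule symmetriesI) (simp_all add: bounded_ops_id self_adjoint_def)

lemma symmetry_norm:
  fixes J :: "'a::complex_hilbert_space \<Rightarrow>\<^sub>L 'a"
  assumes "J \<in> symmetries" shows "norm (J x) = norm x"
proof -
  have "cinner (J x) (J x) = cinner x x"
    using self_adjointD[OF symmetriesD(2)[OF assms], of x "J x"] by (simp add: symmetriesD(3)[OF assms])
  then have "(norm (J x))\<^sup>2 = (norm x)\<^sup>2" by (simp only: Re_cinner_self[symmetric])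
  then show ?thesis by simp
qed

lemma symmetry_le_id:
  fixes J :: "'a::complex_hilbert_space \<Rightarrow>\<^sub>L 'a"
  assumes "J \<in> symmetries" shows "Re (cinner (J x) x) \<le> (norm x)\<^sup>2"
  using cinner_cauchy_schwarz[of "J x" x] complex_Re_le_cmod[of "cinner (J x) x"]
  by (simp add: symmetry_norm[OF assms] power2_eq_square)

lemma loewner_le_id_if_symmetry:
  fixes J :: "'a::complex_hilbert_space \<Rightarrow>\<^sub>L 'a"
  assumes J: "J \<in> symmetries" shows "loewner_le J id_blinfun"
proof -
  have "self_adjoint (id_blinfun - J)"
    using symmetriesD(2)[OF J] by (simp add: self_adjoint_def blinfun.bilinear_simps cinner_simps)
  then show ?thesis
    unfolding loewner_le_def
    using symmetry_le_id[OF J] by (simp add: op_nonneg_iff blinfun.bilinear_simps cinner_simps Re_cinner_self)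
qed

lemma loewner_le_minus_id_if_symmetry:
  fixes J :: "'a::complex_hilbert_space \<Rightarrow>\<^sub>L 'a"
  assumes J: "J \<in> symmetries" shows "loewner_le (- id_blinfun) J"
  using loewner_le_id_if_symmetry[OF symmetry_minus[OF J]] by (simp add: loewner_le_def add.commute)

lemma symmetry_nonneg_eq_id:
  fixes J :: "'a::complex_hilbert_space \<Rightarrow>\<^sub>L 'a"
  assumes J: "J \<in> symmetries" and "op_nonneg J"
  shows "J = id_blinfun"
proof (rule blinfun_eqI)
  fix x
  \<comment> \<open>\<open>w\<close> lies in the eigenspace of \<open>J\<close> for -1, on which
    nonnegativity leaves only 0.\<close>
  define w where "w = J x - x"
  have "J w = - w" by (simp add: w_def blinfun.bilinear_simps symmetriesD(3)[OF J])
  then have "- (norm w)\<^sup>2 \<ge> 0"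
    using op_nonnegD(1)[OF assms(2), of w] by (simp add: cinner_simps Re_cinner_self)
  then have "w = 0" by simp
  then show "J x = id_blinfun x" by (simp add: w_def)
qed

subsection \<open>The real part of an idempotent\<close>

locale idempotent_op =
  fixes P :: "'a::complex_hilbert_space \<Rightarrow>\<^sub>L 'a"
  assumes P_ops: "P \<in> bounded_ops" and P_idem: "P (P x) = P x"
begin

definition A where "A = P + adj P"

lemma Q_ops: "adj P \<in> bounded_ops" by (rule adj_bounded_ops[OF P_ops])

lemma cinner_P: "cinner (P x) y = cinner x (adj P y)" by (rule cinner_adj[OF P_ops])

lemma cinner_Q: "cinner (adj P x) y = cinner x (P y)"
  using cinner_P[of y x] cinner_commute by metis

lemma Q_idem: "adj P (adj P x) = adj P x"
  by (rule cinner_eqI) (simp add: cinner_Q P_idem)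

lemma A_apply: "A x = P x + adj P x" by (simp add: A_def blinfun.bilinear_simps)

lemma A_ops: "A \<in> bounded_ops" unfolding A_def by (intro bounded_ops_add P_ops Q_ops)

lemma A_self_adjoint: "self_adjoint A"
  by (simp add: self_adjoint_def A_apply cinner_simps cinner_P cinner_Q)

text \<open>If \<open>adj P x = - P x\<close>, then \<open>cinner x (P x)\<close> is purely
  imaginary. But the squared norm of \<open>adj P x\<close> is the real part of
  \<open>cinner x (P (adj P x))\<close>, and \<open>P (adj P x) = - P x\<close> by
  idempotence.\<close>

lemma null_space_A:
  assumes "A x = 0" shows "P x = 0" "adj P x = 0"
proof -
  have QP: "adj P x = - P x" using assms by (simp add: A_apply eq_neg_iff_add_eq_0 add.commute)
  have "cinner (P x) x = - cinner x (P x)" by (simp add: cinner_P QP cinner_simps)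
  then have "Re (cinner x (P x)) = 0" using cinner_commute[of x "P x"] by (simp add: complex_eq_iff)
  moreover have "(norm (adj P x))\<^sup>2 = Re (cinner x (P (adj P x)))"
    unfolding Re_cinner_self[symmetric] by (simp add: cinner_Q)
  moreover have "P (adj P x) = - P x" by (simp add: QP blinfun.bilinear_simps P_idem)
  ultimately show "adj P x = 0" by (simp add: cinner_simps)
  with QP show "P x = 0" by simp
qed

text \<open>
  The witness is the sign of \<open>C = P + P\<^sup>* - I\<close>. Since \<open>C\<^sup>2 = I - (P - P\<^sup>*)\<^sup>2 \<ge> I\<close> commutes with
  \<open>P\<close>, so does \<open>R = |C|\<^sup>-\<^sup>1\<close>, and \<open>sgn C P = R C P = R P\<^sup>* P\<close>.
\<close>

lemma ex_sign:
  obtains J where "J \<in> symmetries" "op_nonneg (J o\<^sub>L P)" "\<And>x. A x = 0 \<Longrightarrow> J x = - x"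
proof -
  let ?Q = "adj P"
  define C where "C = A - id_blinfun"
  have C: "C x = P x + ?Q x - x" for x by (simp add: C_def A_apply blinfun.bilinear_simps)
  have CC: "(C o\<^sub>L C) x = x - (P - ?Q) ((P - ?Q) x)" for x
    by (simp add: C blinfun.bilinear_simps P_idem Q_idem)
  obtain R where R: "R \<in> sa_bicommutant (C o\<^sub>L C)" "op_nonneg R" "\<And>x. R (R ((C o\<^sub>L C) x)) = x"
  proof -
    have "\<exists>R \<in> sa_bicommutant (C o\<^sub>L C). op_nonneg R \<and> (\<forall>x. R (R ((C o\<^sub>L C) x)) = x)"
    proof (rule ex_inverse_sqrt)
      show "P - ?Q \<in> bounded_ops" by (intro bounded_ops_diff P_ops Q_ops)
      show "cinner ((P - ?Q) x) y = - cinner x ((P - ?Q) y)" for x y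
        by (simp add: blinfun.bilinear_simps cinner_simps cinner_P cinner_Q)
    qed (rule CC)
    then show ?thesis using that by blast
  qed
  have R_ops: "R \<in> bounded_ops" and R_sa: "self_adjoint R"
    using R(1) by (rule sa_bicommutantD)+
  have RC: "C (R x) = R (C x)" for x
    by (rule sa_bicommutantD(3)[OF R(1)]) simp
  \<comment> \<open>\<open>P\<close> need not commute with \<open>C\<close>, but multiplying the
    square of \<open>C\<close> by \<open>P\<close> on either side gives the product of
    \<open>P\<close>, \<open>adj P\<close> and \<open>P\<close>.\<close>
  have RP: "P (R x) = R (P x)" for x
    by (rule sa_bicommutantD(3)[OF R(1)]) (simp add: C blinfun.bilinear_simps P_idem Q_idem)
  have RQ: "?Q (R x) = R (?Q x)" for x
    by (rule sa_bicommutantD(3)[OF R(1)]) (simp add: C blinfun.bilinear_simps P_idem Q_idem)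
  define J where "J = R o\<^sub>L C"
  have J: "J x = R (C x)" for x by (simp add: J_def)
  have C_ops: "C \<in> bounded_ops" unfolding C_def by (intro bounded_ops_diff A_ops bounded_ops_id)
  have C_sa: "self_adjoint C"
    using A_self_adjoint by (simp add: C_def self_adjoint_def blinfun.bilinear_simps cinner_simps)
  show thesis
  proof (rule that)
    show "J \<in> symmetries"
    proof (rule symmetriesI)
      show "J \<in> bounded_ops" unfolding J_def by (intro bounded_ops_compose R_ops C_ops)
      show "self_adjoint J"
        using R_sa C_sa by (simp add: self_adjoint_def J RC)
      show "J (J x) = x" for x using R(3)[of x] by (simp add: J RC)
    qed
    show "op_nonneg (J o\<^sub>L P)"
      unfolding op_nonneg_def
    proof
      fix x
      have "J (P x) = ?Q (R (P x))" by (simp add: J C P_idem RQ)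
      then have "cinner ((J o\<^sub>L P) x) x = cinner (R (P x)) (P x)" by (simp add: cinner_Q)
      then show "cinner ((J o\<^sub>L P) x) x \<in> \<real>\<^sub>\<ge>\<^sub>0" using R(2) by (simp add: op_nonneg_def)
    qed
    show "J x = - x" if "A x = 0" for x
    proof -
      \<comment> \<open>On the null space of \<open>A\<close>, \<open>C\<close> acts as
        \<open>-I\<close>, so \<open>R\<close> squares to the identity there; being nonnegative, it
        fixes these vectors.\<close>
      have Cx: "C x = - x" using that by (simp add: C_def blinfun.bilinear_simps)
      then have RR: "R (R x) = x" using R(3)[of x] by (simp add: blinfun.bilinear_simps)
      define w where "w = R x - x"
      have "R w = - w" by (simp add: w_def blinfun.bilinear_simps RR)
      then have "- (norm w)\<^sup>2 \<ge> 0"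
        using op_nonnegD(1)[OF R(2), of w] by (simp add: cinner_simps Re_cinner_self)
      then have "w = 0" by simp
      then show ?thesis by (simp add: J Cx blinfun.bilinear_simps w_def)
    qed
  qed
qed

section \<open>The common absolute value and the maximal symmetry\<close>

lemma op_abs_A:
  assumes J: "J \<in> symmetries" and pos: "op_nonneg (J o\<^sub>L P)"
  shows "op_abs A = J o\<^sub>L A" and "J (A x) = A (J x)"
proof -
  note JJ = symmetriesD(3)[OF J]
  have JP_ops: "J o\<^sub>L P \<in> bounded_ops"
    by (intro bounded_ops_compose symmetriesD[OF J] P_ops)
  \<comment> \<open>A nonnegative complex-linear operator is self-adjoint, and the adjoint of
    \<open>J o\<^sub>L P\<close> is \<open>adj P o\<^sub>L J\<close>.\<close>
  have JP: "J (P y) = adj P (J y)" for y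
  proof (rule cinner_eqI_right)
    fix x
    have "cinner x (J (P y)) = cinner (J (P x)) y"
      using self_adjointD[OF self_adjoint_if_op_nonneg[OF JP_ops pos], of x y] by simp
    also have "\<dots> = cinner x (adj P (J y))"
      by (simp add: self_adjointD[OF symmetriesD(2)[OF J]] cinner_P)
    finally show "cinner x (J (P y)) = cinner x (adj P (J y))" .
  qed
  have JQ: "J (adj P y) = P (J y)" for y
    using arg_cong[OF JP[of "J y"], of J] by (simp add: JJ)
  show comm: "J (A x) = A (J x)" for x
    by (simp add: A_apply blinfun.bilinear_simps JP JQ add.commute)
  show "op_abs A = J o\<^sub>L A"
  proof (rule op_abs_eqI)
    show "J o\<^sub>L A \<in> bounded_ops" by (intro bounded_ops_compose symmetriesD[OF J] A_ops)
    show "op_nonneg (J o\<^sub>L A)"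
      unfolding op_nonneg_def
    proof
      fix x
      have "cinner ((J o\<^sub>L A) x) x = cinner ((J o\<^sub>L P) x) x + cinner (J (J (P (J x)))) x"
        by (simp add: A_apply blinfun.bilinear_simps cinner_simps JQ JJ)
      also have "cinner (J (J (P (J x)))) x = cinner ((J o\<^sub>L P) (J x)) (J x)"
        by (simp add: self_adjointD[OF symmetriesD(2)[OF J], of "J _"])
      finally show "cinner ((J o\<^sub>L A) x) x \<in> \<real>\<^sub>\<ge>\<^sub>0"
        using pos by (simp add: op_nonneg_def)
    qed
    show "(J o\<^sub>L A) o\<^sub>L (J o\<^sub>L A) = adj A o\<^sub>L A"
      by (rule blinfun_eqI) (simp add: adj_self_adjoint[OF A_ops A_self_adjoint] comm[symmetric] JJ)
  qed
qed

lemma csubspace_null_space: "csubspace (null_space A)"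
  by (simp add: csubspace_def null_space_def blinfun.bilinear_simps bounded_opsD[OF A_ops])

lemma closed_null_space: "closed (null_space A)"
  unfolding null_space_def by (intro closed_Collect_eq continuous_intros)

text \<open>The positive part of \<open>A\<close> is \<open>E o\<^sub>L A\<close>, where
  \<open>E\<close> projects onto the fixed space of \<open>J\<close>. Its range is dense in that of
  \<open>E\<close>: what is missing would lie in the null space of \<open>A\<close>, where
  \<open>J\<close> is \<open>-I\<close>, while \<open>J\<close> fixes the range of
  \<open>E\<close>.\<close>

lemma range_proj_pos_part:
  assumes J: "J \<in> symmetries" "op_nonneg (J o\<^sub>L P)" and neg: "\<And>x. A x = 0 \<Longrightarrow> J x = - x"
  shows "2 *\<^sub>R range_proj (pos_part A) - id_blinfun = J"
proof -
  define E where "E = (1/2) *\<^sub>R (J + id_blinfun)"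
  note JJ = symmetriesD(3)[OF J(1)] and comm = op_abs_A(2)[OF J]
  have E: "E x = (1/2) *\<^sub>R (J x + x)" for x by (simp add: E_def blinfun.bilinear_simps)
  have JE: "J (E x) = E x" for x by (simp add: E blinfun.bilinear_simps JJ add.commute)
  have EE: "E (E x) = E x" for x by (simp add: E[of "E x"] JE scaleR_half_double)
  have E_sa: "cinner (E x) y = cinner x (E y)" for x y
    using symmetriesD(2)[OF J(1)] by (simp add: E self_adjoint_def cinner_simps)
  have E_ops: "E \<in> bounded_ops"
    unfolding E_def by (intro bounded_ops_closure symmetriesD[OF J(1)])
  let ?B = "pos_part A"
  have B: "?B x = E (A x)" for x
    by (simp add: pos_part_def op_abs_A(1)[OF J] E blinfun.bilinear_simps)
  let ?M = "closure (range ?B)"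
  have "csubspace (range ?B)"
    unfolding csubspace_def
  proof (intro conjI ballI allI)
    show "0 \<in> range ?B" by (rule range_eqI[of _ _ 0]) (simp add: blinfun.bilinear_simps)
    show "x + y \<in> range ?B" if "x \<in> range ?B" "y \<in> range ?B" for x y
      using that by (auto simp: blinfun.bilinear_simps intro: range_eqI[of _ _ "_ + _"])
    show "c *\<^sub>C x \<in> range ?B" if "x \<in> range ?B" for c x
      using that by (auto simp: B bounded_opsD[OF A_ops] bounded_opsD[OF E_ops] intro: range_eqI[of _ _ "c *\<^sub>C _"])
  qed
  then have M: "csubspace ?M" "closed ?M" by (simp_all add: csubspace_closure)
  define F where "F = orth_proj ?M"
  note F = orth_proj_correct[OF M, folded F_def]
  have "F x = E x" for x
  proof -
    have "?M \<subseteq> {y. E y = y}"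
    proof (rule closure_minimal)
      show "range ?B \<subseteq> {y. E y = y}" by (auto simp: B EE)
      show "closed {y. E y = y}" by (intro closed_Collect_eq continuous_intros)
    qed
    then have EF: "E (F x) = F x" using F(2) by blast
    define z where "z = x - F x"
    have "A (E z) = 0"
    proof (rule cinner_eqI)
      fix u
      have "cinner (A (E z)) u = cinner z (?B u)"
        by (simp add: B self_adjointD[OF A_self_adjoint] E_sa)
      also have "\<dots> = 0" unfolding z_def by (rule F(3)) (simp add: closure_subset[THEN subsetD])
      finally show "cinner (A (E z)) u = cinner 0 u" by simp
    qed
    then have "J (E z) = - E z" by (rule neg)
    then have "E z = - E z" by (simp add: JE)
    then have "E z = 0" by (metis scaleR_half_double add_eq_0_iff2 scaleR_zero_right)
    then show ?thesis by (simp add: z_def blinfun.bilinear_simps EF)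
  qed
  then have "F = E" by (rule blinfun_eqI)
  then show ?thesis unfolding range_proj_def F_def[symmetric] by (simp add: E_def)
qed

lemma max_symmetry:
  "is_loewner_max {J \<in> symmetries. op_nonneg (J o\<^sub>L P)}
    (2 *\<^sub>R range_proj (pos_part A) - id_blinfun + 2 *\<^sub>R orth_proj (null_space A))"
proof -
  obtain J1 where J1: "J1 \<in> symmetries" "op_nonneg (J1 o\<^sub>L P)" "\<And>x. A x = 0 \<Longrightarrow> J1 x = - x"
    using ex_sign by blast
  define N where "N = orth_proj (null_space A)"
  note N = orth_proj_correct[OF csubspace_null_space closed_null_space, folded N_def]
  have AN: "A (N x) = 0" for x using N(2)[of x] by (simp add: null_space_def)
  have N_fix: "N x = x" if "A x = 0" for x
  proof -
    have "A (x - N x) = 0" using that AN by (simp add: blinfun.bilinear_simps)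
    then have "cinner (x - N x) (x - N x) = 0" by (intro N(3)) (simp add: null_space_def)
    then show ?thesis by (simp add: cinner_self_eq_0)
  qed
  have N_left: "cinner (N x) y = cinner (N x) (N y)" for x y
    using N(3)[OF N(2), of y x] cinner_commute[of "y - N y" "N x"] by (simp add: cinner_simps)
  have N_right: "cinner x (N y) = cinner (N x) (N y)" for x y
    using N(3)[OF N(2), of x y] by (simp add: cinner_simps)
  have N_sa: "cinner (N x) y = cinner x (N y)" for x y
    by (rule trans[OF N_left N_right[symmetric]])
  have J1N: "J1 (N x) = - N x" for x by (rule J1(3)[OF AN])
  have NJ1: "N (J1 x) = - N x" for x
    by (rule cinner_eqI_right)
      (simp add: N_sa[symmetric] self_adjointD[OF symmetriesD(2)[OF J1(1)], symmetric] J1N cinner_simps)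
  \<comment> \<open>The range of \<open>P\<close> is orthogonal to the null space of
    \<open>A\<close>, because \<open>adj P\<close> vanishes there. Hence changing a symmetry by a
    multiple of \<open>N\<close> does not affect its product with \<open>P\<close>.\<close>
  have NP: "N (P x) = 0" for x
    by (rule cinner_eqI) (simp add: N_sa cinner_P null_space_A[OF AN])
  \<comment> \<open>\<open>J1\<close> is \<open>-I\<close> on the null space of \<open>A\<close>;
    the summand flips it to \<open>I\<close> there.\<close>
  define J0 where "J0 = J1 + 2 *\<^sub>R N"
  have J0: "J0 x = J1 x + 2 *\<^sub>R N x" for x by (simp add: J0_def blinfun.bilinear_simps)
  have "is_loewner_max {J \<in> symmetries. op_nonneg (J o\<^sub>L P)} J0"
    unfolding is_loewner_max_def
  proof (intro conjI ballI CollectI)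
    show "J0 \<in> symmetries"
    proof (rule symmetriesI)
      show "J0 \<in> bounded_ops"
        unfolding J0_def by (intro bounded_ops_closure symmetriesD[OF J1(1)] N(1))
      show "self_adjoint J0"
        using symmetriesD(2)[OF J1(1)] by (simp add: self_adjoint_def J0 cinner_simps N_sa)
      show "J0 (J0 x) = x" for x
        by (simp add: J0 blinfun.bilinear_simps symmetriesD(3)[OF J1(1)] J1N NJ1 N_fix[OF AN] scaleR_2)
    qed
    have "J0 o\<^sub>L P = J1 o\<^sub>L P" by (rule blinfun_eqI) (simp add: J0 NP)
    then show "op_nonneg (J0 o\<^sub>L P)" using J1(2) by simp
    fix J assume "J \<in> {J \<in> symmetries. op_nonneg (J o\<^sub>L P)}"
    then have J: "J \<in> symmetries" "op_nonneg (J o\<^sub>L P)" by auto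
    have "J o\<^sub>L A = J1 o\<^sub>L A" using op_abs_A(1)[OF J] op_abs_A(1)[OF J1(1,2)] by simp
    then have JA: "J (A x) = J1 (A x)" for x
      by (metis blinfun_apply_blinfun_compose)
    \<comment> \<open>\<open>K\<close> kills the range of \<open>A\<close> because both symmetries
      turn \<open>A\<close> into its absolute value. Since both commute with \<open>A\<close>,
      \<open>K\<close> also maps into the null space, so it is compressed by \<open>N\<close> on
      both sides.\<close>
    define K where "K = J1 - J"
    have K_sa: "cinner (K x) y = cinner x (K y)" for x y
      using symmetriesD(2)[OF J1(1)] symmetriesD(2)[OF J(1)]
      by (simp add: K_def self_adjoint_def blinfun.bilinear_simps cinner_simps)
    have AK: "A (K x) = 0" for x
      using op_abs_A(2)[OF J, of x] op_abs_A(2)[OF J1(1,2), of x]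
      by (simp add: K_def blinfun.bilinear_simps JA)
    have K_N: "cinner (K x) x = cinner (K (N x)) (N x)" for x
    proof -
      have NK: "N (K y) = K y" for y by (rule N_fix[OF AK])
      have "cinner (K x) x = cinner (K x) (N x)" using N_sa[of "K x" x] by (simp add: NK)
      also have "\<dots> = cinner x (N (K (N x)))" by (simp add: K_sa NK)
      also have "\<dots> = cinner (K (N x)) (N x)" by (rule trans[OF N_sa[symmetric] K_sa[symmetric]])
      finally show ?thesis .
    qed
    have sa: "self_adjoint (J0 - J)"
      using symmetriesD(2)[OF J1(1)] symmetriesD(2)[OF J(1)]
      by (simp add: self_adjoint_def blinfun.bilinear_simps J0 cinner_simps N_sa)
    show "loewner_le J J0"
      unfolding loewner_le_def op_nonneg_iff[OF sa]
    proof
      fix x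
      \<comment> \<open>Everything reduces to \<open>N x\<close>, where \<open>J0\<close> is the
        identity and no symmetry exceeds it.\<close>
      have "cinner ((J0 - J) x) x = cinner (K x) x + 2 * cinner (N x) x"
        by (simp add: J0 K_def blinfun.bilinear_simps cinner_simps)
      also have "\<dots> = cinner (K (N x)) (N x) + 2 * cinner (N x) (N x)"
        by (simp only: K_N[of x] N_left[of x x])
      also have "\<dots> = cinner (N x) (N x) - cinner (J (N x)) (N x)"
        by (simp add: K_def blinfun.bilinear_simps J1N cinner_simps)
      finally show "Re (cinner ((J0 - J) x) x) \<ge> 0"
        using symmetry_le_id[OF J(1), of "N x"] by (simp add: Re_cinner_self)
    qed
  qed
  then show ?thesis
    by (simp only: range_proj_pos_part[OF J1] J0_def N_def)
qed

end

subsection \<open>Symmetries intertwining \<open>P\<close> and its adjoint\<close>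

lemma intertwiner_extremum_eq:
  fixes P :: "'a::complex_hilbert_space \<Rightarrow>\<^sub>L 'a"
  defines "S \<equiv> {J \<in> symmetries. J o\<^sub>L P o\<^sub>L J = adj P}"
  shows intertwiner_max_eq: "is_loewner_max S M \<Longrightarrow> M = id_blinfun"
    and intertwiner_min_eq: "is_loewner_min S M \<Longrightarrow> M = - id_blinfun"
proof -
  have neg: "- J \<in> S" if "J \<in> S" for J
  proof -
    have "(- J) o\<^sub>L P o\<^sub>L (- J) = J o\<^sub>L P o\<^sub>L J"
      by (rule blinfun_eqI) (simp add: blinfun.bilinear_simps)
    with that show ?thesis by (simp add: S_def symmetry_minus)
  qed
  \<comment> \<open>Comparing an extremum \<open>M\<close> with \<open>- M\<close> yields the sign
    of \<open>2 M\<close>; this removes the factor 2.\<close>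
  have half: "op_nonneg (T - - T) \<Longrightarrow> op_nonneg T" for T :: "'a \<Rightarrow>\<^sub>L 'a"
    by (auto simp: op_nonneg_def complex_nonneg_Reals_iff blinfun.bilinear_simps cinner_simps)
  show "M = id_blinfun" if "is_loewner_max S M"
  proof (rule symmetry_nonneg_eq_id)
    have M: "M \<in> S" using that by (simp add: is_loewner_max_def)
    then show "M \<in> symmetries" by (simp add: S_def)
    show "op_nonneg M"
      by (rule half) (use that neg[OF M] in \<open>unfold is_loewner_max_def loewner_le_def, blast\<close>)
  qed
  show "M = - id_blinfun" if "is_loewner_min S M"
  proof -
    have M: "M \<in> S" using that by (simp add: is_loewner_min_def)
    then have "- M \<in> symmetries" by (simp add: S_def symmetry_minus)
    moreover have "op_nonneg (- M - M)"
      using that neg[OF M] unfolding is_loewner_min_def loewner_le_def by blast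
    then have "op_nonneg (- M)" by (intro half[of "- M"]) simp
    ultimately have "- M = id_blinfun" by (rule symmetry_nonneg_eq_id)
    then show ?thesis by (metis minus_minus)
  qed
qed

theorem theorem8:
  fixes P :: "'a::complex_hilbert_space \<Rightarrow>\<^sub>L 'a"
  assumes "separable_space (euclidean :: 'a topology)"
    and "P \<in> bounded_ops"
    and "P o\<^sub>L P = P"
  shows "is_loewner_max {J \<in> symmetries. op_nonneg (J o\<^sub>L P)}
           (2 *\<^sub>R range_proj (pos_part (P + adj P)) - id_blinfun
             + 2 *\<^sub>R orth_proj (null_space (P + adj P)))
    \<and> (let S = {J \<in> symmetries. J o\<^sub>L P o\<^sub>L J = adj P};
             a = (\<exists>M. is_loewner_max S M);
             b = is_orth_proj P;
             c = is_loewner_max S id_blinfun;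
             d = (\<exists>M. is_loewner_min S M);
             e = is_loewner_min S (- id_blinfun)
         in (a \<longleftrightarrow> b) \<and> (b \<longleftrightarrow> c) \<and> (c \<longleftrightarrow> d) \<and> (d \<longleftrightarrow> e))"
proof (rule conjI)
  have idem: "P (P x) = P x" for x
    using arg_cong[OF assms(3), of "\<lambda>T. blinfun_apply T x"] by simp
  interpret idempotent_op P by standard (use assms(2) idem in auto)
  show "is_loewner_max {J \<in> symmetries. op_nonneg (J o\<^sub>L P)}
           (2 *\<^sub>R range_proj (pos_part (P + adj P)) - id_blinfun
             + 2 *\<^sub>R orth_proj (null_space (P + adj P)))"
    using max_symmetry by (simp only: A_def)
  define S where "S = {J \<in> symmetries. J o\<^sub>L P o\<^sub>L J = adj P}"
  \<comment> \<open>Conjugation by either sign of the identity fixes \<open>P\<close>, so membership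
    of these operators in \<open>S\<close> amounts to \<open>adj P = P\<close>.\<close>
  have id_P: "id_blinfun o\<^sub>L P o\<^sub>L id_blinfun = P" "(- id_blinfun) o\<^sub>L P o\<^sub>L (- id_blinfun) = P"
    by (rule blinfun_eqI, simp add: blinfun.bilinear_simps)+
  have orth: "is_orth_proj P \<longleftrightarrow> adj P = P" using assms by (simp add: is_orth_proj_def)
  have max: "is_loewner_max S id_blinfun \<longleftrightarrow> is_orth_proj P"
    unfolding orth is_loewner_max_def S_def
    by (auto simp: id_P id_symmetry loewner_le_id_if_symmetry)
  have min: "is_loewner_min S (- id_blinfun) \<longleftrightarrow> is_orth_proj P"
    unfolding orth is_loewner_min_def S_def
    by (auto simp: id_P symmetry_minus[OF id_symmetry] loewner_le_minus_id_if_symmetry)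
  have ex: "(\<exists>M. is_loewner_max S M) \<longleftrightarrow> is_loewner_max S id_blinfun"
    "(\<exists>M. is_loewner_min S M) \<longleftrightarrow> is_loewner_min S (- id_blinfun)"
    using intertwiner_max_eq intertwiner_min_eq unfolding S_def by blast+
  show "let S = {J \<in> symmetries. J o\<^sub>L P o\<^sub>L J = adj P};
             a = (\<exists>M. is_loewner_max S M);
             b = is_orth_proj P;
             c = is_loewner_max S id_blinfun;
             d = (\<exists>M. is_loewner_min S M);
             e = is_loewner_min S (- id_blinfun)
         in (a \<longleftrightarrow> b) \<and> (b \<longleftrightarrow> c) \<and> (c \<longleftrightarrow> d) \<and> (d \<longleftrightarrow> e)"
    unfolding Let_def S_def[symmetric] by (simp add: ex max min)
qed

end
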